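(* Let $A$ be a unital $\mathrm{C}^*$-algebra containing a closed two-sided ideal $J$ and an operator system $X$. Let $\Pi:\mathcal{B}(X,J)\to B(H)$ be a unital $*$-representation annihilating $\mathbb{M}_2(J)$, and let $\pi:\mathrm{C}^*(X)+J\to B(H)$ be the unique $*$-representation such that the pair $(\Pi,\pi)$ is $(X,J)$-adapted. Then the following are equivalent: (i) $\Pi$ has the unique extension property with respect to $\mathcal{S}(X,J)$; (ii) $\pi$ is the unique contractive completely positive map $\mathrm{C}^*(X)+J\to B(H)$ agreeing with $\pi$ on $X$.
   Context: An operator system is a norm-closed self-adjoint subspace containing the unit; $\mathrm{C}^*(X)$ is the $\mathrm{C}^*$-subalgebra of $A$ generated by $X$, and $\mathrm{C}^*(X)+J$ is a $\mathrm{C}^*$-subalgebra of $A$. $\mathcal{S}(X,J)\subset\mathbb{M}_2(A)$ is the operator system of matrices $\begin{bmatrix} x & j\\ k & b\end{bmatrix}$ with $x\in X$, $j,k\in J$, $b\in J+\mathbb{C}1$; $\mathcal{B}(X,J)$ is the $\mathrm{C}^*$-algebra it generates in $\mathbb{M}_2(A)$, and it consists exactly of the matrices $\begin{bmatrix} a & b\\ c & d\end{bmatrix}$ with $a\in\mathrm{C}^*(X)+J$, $b,c\in J$, $d\in J+\mathbb{C}1$. Let $\chi:J+\mathbb{C}1\to\mathbb{C}$ be the quotient map by $J$ ($\chi(j+\lambda 1)=\lambda$). Given $*$-representations $\Pi:\mathcal{B}(X,J)\to B(H)$ and $\pi:\mathrm{C}^*(X)+J\to B(H)$, the pair $(\Pi,\pi)$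 is called $(X,J)$-adapted if $\Pi\left(\begin{bmatrix} a & b\\ c& d\end{bmatrix}\right)-\chi(d)1=\pi(a-\chi(d)1)$ for every $\begin{bmatrix} a & b\\ c& d\end{bmatrix}\in\mathcal{B}(X,J)$. (For $\Pi$ as in the claim such a $\pi$ exists and is unique.) A unital $*$-representation $\Pi$ of $\mathcal{B}(X,J)$ has the unique extension property with respect to $\mathcal{S}(X,J)$ if every unital completely positive map on $\mathcal{B}(X,J)$ agreeing with $\Pi$ on $\mathcal{S}(X,J)$ equals $\Pi$. *)

theory Defs
  imports "HOL-Analysis.Analysis"
begin

class chilbert = ab_group_add +
  fixes hscale :: "complex \<Rightarrow> 'a \<Rightarrow> 'a"
    and cinner :: "'a \<Rightarrow> 'a \<Rightarrow> complex"
  assumes hscale_add_right: "hscale c (x + y) = hscale c x + hscale c y"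
    and hscale_add_left: "hscale (c + d) x = hscale c x + hscale d x"
    and hscale_hscale: "hscale c (hscale d x) = hscale (c * d) x"
    and hscale_one: "hscale 1 x = x"
    and cinner_add_left: "cinner (x + y) z = cinner x z + cinner y z"
    and cinner_hscale_left: "cinner (hscale c x) y = c * cinner x y"
    and cinner_commute: "cinner y x = cnj (cinner x y)"
    and cinner_self_nonneg: "Im (cinner x x) = 0 \<and> 0 \<le> Re (cinner x x)"
    and cinner_self_zero: "cinner x x = 0 \<Longrightarrow> x = 0"
    and hilbert_complete: "(\<forall>e>0. \<exists>N. \<forall>m\<ge>N. \<forall>n\<ge>N.
            sqrt (Re (cinner (S m - S n) (S m - S n))) < e)
         \<Longrightarrow> (\<exists>L. (\<lambda>n. sqrt (Re (cinner (S n - L) (S n - L)))) \<longlonglongrightarrow> 0)"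

definition hnorm :: "'h::chilbert \<Rightarrow> real" where
  "hnorm x = sqrt (Re (cinner x x))"

definition bop :: "('h::chilbert \<Rightarrow> 'h) \<Rightarrow> bool" where
  "bop T \<longleftrightarrow> (\<forall>x y. T (x + y) = T x + T y) \<and> (\<forall>c x. T (hscale c x) = hscale c (T x))
     \<and> (\<exists>K. \<forall>x. hnorm (T x) \<le> K * hnorm x)"

definition pos_opmat :: "nat \<Rightarrow> (nat \<Rightarrow> nat \<Rightarrow> 'h::chilbert \<Rightarrow> 'h) \<Rightarrow> bool" where
  "pos_opmat n T \<longleftrightarrow> (\<forall>\<xi> :: nat \<Rightarrow> 'h.
      Im (\<Sum>i<n. \<Sum>j<n. cinner (T i j (\<xi> j)) (\<xi> i)) = 0 \<and>
      0 \<le> Re (\<Sum>i<n. \<Sum>j<n. cinner (T i j (\<xi> j)) (\<xi> i)))"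

class cstar_alg = real_normed_algebra_1 + banach +
  fixes cscale :: "complex \<Rightarrow> 'a \<Rightarrow> 'a"
    and cstar :: "'a \<Rightarrow> 'a"
  assumes cscale_add_right: "cscale c (x + y) = cscale c x + cscale c y"
    and cscale_add_left: "cscale (c + d) x = cscale c x + cscale d x"
    and cscale_cscale: "cscale c (cscale d x) = cscale (c * d) x"
    and cscale_one: "cscale 1 x = x"
    and cscale_of_real: "cscale (complex_of_real r) x = scaleR r x"
    and cscale_mult_left: "cscale c x * y = cscale c (x * y)"
    and cscale_mult_right: "x * cscale c y = cscale c (x * y)"
    and norm_cscale: "norm (cscale c x) = cmod c * norm x"
    and cstar_cstar: "cstar (cstar x) = x"
    and cstar_add: "cstar (x + y) = cstar x + cstar y"
    and cstar_cscale: "cstar (cscale c x) = cscale (cnj c) (cstar x)"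
    and cstar_mult: "cstar (x * y) = cstar y * cstar x"
    and cstar_identity: "norm (cstar x * x) = norm x * norm x"

definition csubspace :: "'a::cstar_alg set \<Rightarrow> bool" where
  "csubspace S \<longleftrightarrow> 0 \<in> S \<and> (\<forall>x\<in>S. \<forall>y\<in>S. x + y \<in> S) \<and> (\<forall>c. \<forall>x\<in>S. cscale c x \<in> S)"

definition closed_ideal :: "'a::cstar_alg set \<Rightarrow> bool" where
  "closed_ideal J \<longleftrightarrow> csubspace J \<and> closed J \<and> (\<forall>a. \<forall>j\<in>J. a * j \<in> J \<and> j * a \<in> J)"

definition operator_system :: "'a::cstar_alg set \<Rightarrow> bool" where
  "operator_system X \<longleftrightarrow> csubspace X \<and> closed X \<and> 1 \<in> X \<and> (\<forall>x\<in>X. cstar x \<in> X)"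

definition cstar_subalgebra :: "'a::cstar_alg set \<Rightarrow> bool" where
  "cstar_subalgebra B \<longleftrightarrow> csubspace B \<and> closed B \<and> (\<forall>x\<in>B. \<forall>y\<in>B. x * y \<in> B)
      \<and> (\<forall>x\<in>B. cstar x \<in> B)"

definition cstar_gen :: "'a::cstar_alg set \<Rightarrow> 'a set" where
  "cstar_gen X = \<Inter>{B. cstar_subalgebra B \<and> X \<subseteq> B}"

definition setsum :: "'a::cstar_alg set \<Rightarrow> 'a set \<Rightarrow> 'a set" where
  "setsum C J = {x + j | x j. x \<in> C \<and> j \<in> J}"

definition unitize :: "'a::cstar_alg set \<Rightarrow> 'a set" where
  "unitize J = {j + cscale l 1 | j l. j \<in> J}"

text \<open>chi : J + C1 -> C, the quotient map by J.\<close>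
definition chi :: "'a::cstar_alg set \<Rightarrow> 'a \<Rightarrow> complex" where
  "chi J d = (THE l. d - cscale l 1 \<in> J)"

section \<open>2 x 2 matrices over A; (a,b,c,d) stands for [a b; c d]\<close>

type_synonym 'a m2 = "'a \<times> 'a \<times> 'a \<times> 'a"

definition m2_add :: "'a::cstar_alg m2 \<Rightarrow> 'a m2 \<Rightarrow> 'a m2" where
  "m2_add m n = (case m of (a,b,c,d) \<Rightarrow> case n of (a',b',c',d') \<Rightarrow> (a+a', b+b', c+c', d+d'))"

definition m2_scale :: "complex \<Rightarrow> 'a::cstar_alg m2 \<Rightarrow> 'a m2" where
  "m2_scale l m = (case m of (a,b,c,d) \<Rightarrow> (cscale l a, cscale l b, cscale l c, cscale l d))"

definition m2_mult :: "'a::cstar_alg m2 \<Rightarrow> 'a m2 \<Rightarrow> 'a m2" where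
  "m2_mult m n = (case m of (a,b,c,d) \<Rightarrow> case n of (a',b',c',d') \<Rightarrow>
     (a*a' + b*c', a*b' + b*d', c*a' + d*c', c*b' + d*d'))"

definition m2_star :: "'a::cstar_alg m2 \<Rightarrow> 'a m2" where
  "m2_star m = (case m of (a,b,c,d) \<Rightarrow> (cstar a, cstar c, cstar b, cstar d))"

definition m2_one :: "'a::cstar_alg m2" where
  "m2_one = (1, 0, 0, 1)"

definition m2_entry :: "'a m2 \<Rightarrow> nat \<Rightarrow> nat \<Rightarrow> 'a" where
  "m2_entry m i j = (case m of (a,b,c,d) \<Rightarrow>
     (if i = 0 then (if j = 0 then a else b) else (if j = 0 then c else d)))"

definition SXJ :: "'a::cstar_alg set \<Rightarrow> 'a set \<Rightarrow> 'a m2 set" where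
  "SXJ X J = {(x,j,k,b) | x j k b. x \<in> X \<and> j \<in> J \<and> k \<in> J \<and> b \<in> unitize J}"

definition BXJ :: "'a::cstar_alg set \<Rightarrow> 'a set \<Rightarrow> 'a m2 set" where
  "BXJ X J = {(a,b,c,d) | a b c d. a \<in> setsum (cstar_gen X) J \<and> b \<in> J \<and> c \<in> J \<and> d \<in> unitize J}"

definition M2 :: "'a set \<Rightarrow> 'a m2 set" where
  "M2 J = {(a,b,c,d) | a b c d. a \<in> J \<and> b \<in> J \<and> c \<in> J \<and> d \<in> J}"

definition mprod :: "nat \<Rightarrow> (nat \<Rightarrow> nat \<Rightarrow> 'a::cstar_alg) \<Rightarrow> (nat \<Rightarrow> nat \<Rightarrow> 'a) \<Rightarrow> nat \<Rightarrow> nat \<Rightarrow> 'a" where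
  "mprod n M N = (\<lambda>i j. \<Sum>k<n. M i k * N k j)"

definition madj :: "(nat \<Rightarrow> nat \<Rightarrow> 'a::cstar_alg) \<Rightarrow> nat \<Rightarrow> nat \<Rightarrow> 'a" where
  "madj M = (\<lambda>i j. cstar (M j i))"

definition pos_mat_A :: "'a::cstar_alg set \<Rightarrow> nat \<Rightarrow> (nat \<Rightarrow> nat \<Rightarrow> 'a) \<Rightarrow> bool" where
  "pos_mat_A D n F \<longleftrightarrow> (\<exists>G. (\<forall>i<n. \<forall>j<n. G i j \<in> D) \<and>
      (\<forall>i<n. \<forall>j<n. F i j = mprod n (madj G) G i j))"

text \<open>M_n(M_2(A)) identified with M_{2n}(A) (block ordering).\<close>
definition flat2 :: "(nat \<Rightarrow> nat \<Rightarrow> 'a m2) \<Rightarrow> nat \<Rightarrow> nat \<Rightarrow> 'a" where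
  "flat2 F = (\<lambda>i j. m2_entry (F (i div 2) (j div 2)) (i mod 2) (j mod 2))"

definition pos_mat_M2 :: "'a::cstar_alg m2 set \<Rightarrow> nat \<Rightarrow> (nat \<Rightarrow> nat \<Rightarrow> 'a m2) \<Rightarrow> bool" where
  "pos_mat_M2 D n F \<longleftrightarrow> (\<exists>G. (\<forall>i<n. \<forall>j<n. G i j \<in> D) \<and>
      (\<forall>i<2*n. \<forall>j<2*n. flat2 F i j = mprod (2*n) (madj (flat2 G)) (flat2 G) i j))"

definition comp_pos :: "(nat \<Rightarrow> (nat \<Rightarrow> nat \<Rightarrow> 'b) \<Rightarrow> bool) \<Rightarrow> 'b set \<Rightarrow> ('b \<Rightarrow> 'h::chilbert \<Rightarrow> 'h) \<Rightarrow> bool" where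
  "comp_pos posD D \<phi> \<longleftrightarrow> (\<forall>n F. (\<forall>i<n. \<forall>j<n. F i j \<in> D) \<and> posD n F \<longrightarrow>
      pos_opmat n (\<lambda>i j. \<phi> (F i j)))"

definition lin_map_on :: "('b \<Rightarrow> 'b \<Rightarrow> 'b) \<Rightarrow> (complex \<Rightarrow> 'b \<Rightarrow> 'b) \<Rightarrow> 'b set \<Rightarrow> ('b \<Rightarrow> 'h::chilbert \<Rightarrow> 'h) \<Rightarrow> bool" where
  "lin_map_on pl sc D \<phi> \<longleftrightarrow> (\<forall>a\<in>D. bop (\<phi> a)) \<and>
     (\<forall>a\<in>D. \<forall>b\<in>D. \<phi> (pl a b) = (\<lambda>x. \<phi> a x + \<phi> b x)) \<and>
     (\<forall>c. \<forall>a\<in>D. \<phi> (sc c a) = (\<lambda>x. hscale c (\<phi> a x)))"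

definition star_rep :: "('b \<Rightarrow> 'b \<Rightarrow> 'b) \<Rightarrow> (complex \<Rightarrow> 'b \<Rightarrow> 'b) \<Rightarrow> ('b \<Rightarrow> 'b \<Rightarrow> 'b) \<Rightarrow> ('b \<Rightarrow> 'b)
    \<Rightarrow> 'b set \<Rightarrow> ('b \<Rightarrow> 'h::chilbert \<Rightarrow> 'h) \<Rightarrow> bool" where
  "star_rep pl sc ml st D \<rho> \<longleftrightarrow> lin_map_on pl sc D \<rho> \<and>
     (\<forall>a\<in>D. \<forall>b\<in>D. \<rho> (ml a b) = \<rho> a \<circ> \<rho> b) \<and>
     (\<forall>a\<in>D. \<forall>x y. cinner (\<rho> (st a) x) y = cinner x (\<rho> a y))"

abbreviation star_rep_A :: "'a::cstar_alg set \<Rightarrow> ('a \<Rightarrow> 'h::chilbert \<Rightarrow> 'h) \<Rightarrow> bool" where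
  "star_rep_A D \<rho> \<equiv> star_rep (+) cscale (*) cstar D \<rho>"

abbreviation star_rep_M2 :: "'a::cstar_alg m2 set \<Rightarrow> ('a m2 \<Rightarrow> 'h::chilbert \<Rightarrow> 'h) \<Rightarrow> bool" where
  "star_rep_M2 D \<rho> \<equiv> star_rep m2_add m2_scale m2_mult m2_star D \<rho>"

definition ucp_M2 :: "'a::cstar_alg m2 set \<Rightarrow> ('a m2 \<Rightarrow> 'h::chilbert \<Rightarrow> 'h) \<Rightarrow> bool" where
  "ucp_M2 D \<phi> \<longleftrightarrow> lin_map_on m2_add m2_scale D \<phi> \<and> \<phi> m2_one = id \<and> comp_pos (pos_mat_M2 D) D \<phi>"

definition ccp_A :: "'a::cstar_alg set \<Rightarrow> ('a \<Rightarrow> 'h::chilbert \<Rightarrow> 'h) \<Rightarrow> bool" where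
  "ccp_A D \<phi> \<longleftrightarrow> lin_map_on (+) cscale D \<phi> \<and> comp_pos (pos_mat_A D) D \<phi> \<and>
     (\<forall>a\<in>D. \<forall>x. hnorm (\<phi> a x) \<le> norm a * hnorm x)"

definition UEP :: "'a::cstar_alg set \<Rightarrow> 'a set \<Rightarrow> ('a m2 \<Rightarrow> 'h::chilbert \<Rightarrow> 'h) \<Rightarrow> bool" where
  "UEP X J PI \<longleftrightarrow> (\<forall>\<phi>. ucp_M2 (BXJ X J) \<phi> \<and> (\<forall>s\<in>SXJ X J. \<phi> s = PI s)
       \<longrightarrow> (\<forall>b\<in>BXJ X J. \<phi> b = PI b))"

definition adapted :: "'a::cstar_alg set \<Rightarrow> 'a set \<Rightarrow> ('a m2 \<Rightarrow> 'h::chilbert \<Rightarrow> 'h) \<Rightarrow> ('a \<Rightarrow> 'h \<Rightarrow> 'h) \<Rightarrow> bool" where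
  "adapted X J PI \<pi> \<longleftrightarrow> (\<forall>a b c d. (a,b,c,d) \<in> BXJ X J \<longrightarrow>
      (\<lambda>x. PI (a,b,c,d) x - hscale (chi J d) x) = \<pi> (a - cscale (chi J d) 1))"

end

theory Submission
  imports Defs
begin

text \<open>
  Since \<open>\<Pi>\<close> annihilates \<open>M\<^sub>2(J)\<close>, it is the sum of \<open>\<pi>\<close> on the upper left corner and of the
  character \<open>d \<mapsto> \<chi>(d) (1 - \<pi>(1))\<close> on the lower right one. Replacing \<open>\<pi>\<close> here by a
  contractive completely positive map that agrees with it on \<open>X\<close> gives a unital completely
  positive map agreeing with \<open>\<Pi>\<close> on \<open>S(X, J)\<close>; conversely, compressing a unital completely
  positive map to the upper left corner gives a completely positive map \<open>\<psi>\<close> with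
  \<open>\<psi>(1) = \<pi>(1) \<le> 1\<close>, and such maps are contractive. What remains is C*-theory: that \<open>J\<close> is
  self-adjoint, and that \<open>1 - a\<^sup>* a\<close> has a square root in \<open>C\<^sup>*(X) + J\<close> for \<open>\<parallel>a\<parallel> \<le> 1\<close>. Both
  follow from the binomial series of \<open>(1 - z)\<^sup>1\<^sup>/\<^sup>2\<close>, which converges absolutely on the
  closed unit ball.
\<close>

section \<open>The square root series\<close>

text \<open>The Taylor coefficients of (1 - t)^(1/2): those of (1 - t)^(-a) are
  \<open>pochhammer a n / fact n\<close>, here with \<open>a = - 1 / 2\<close>.\<close>

definition root_coeff :: "nat \<Rightarrow> real" where
  "root_coeff n = pochhammer (- 1 / 2) n / fact n"

lemma root_coeff_0 [simp]: "root_coeff 0 = 1"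
  by (simp add: root_coeff_def)

text \<open>Only the first factor of the rising factorial, \<open>- 1 / 2\<close>, is
  negative.\<close>

lemma root_coeff_Suc_nonpos: "root_coeff (Suc n) \<le> 0"
proof -
  have "pochhammer (- 1 / 2 :: real) (Suc n) = (- 1 / 2) * pochhammer (1 / 2) n"
    by (subst pochhammer_rec) simp
  moreover have "0 \<le> pochhammer (1 / 2 :: real) n"
    by (simp add: pochhammer_nonneg)
  ultimately show ?thesis
    by (simp add: root_coeff_def divide_nonpos_pos del: fact_Suc)
qed

text \<open>Taking partial sums multiplies the series by 1 / (1 - t), which turns (1 - t)^(1/2) into
  (1 - t)^(-1/2).\<close>

lemma sum_root_coeff: "(\<Sum>k\<le>n. root_coeff k) = pochhammer (1 / 2) n / fact n"
proof (induction n)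
  case 0
  then show ?case by simp
next
  case (Suc n)
  have p: "pochhammer (- 1 / 2 :: real) (Suc n) = (- 1 / 2) * pochhammer (1 / 2) n"
    by (subst pochhammer_rec) simp
  have "root_coeff (Suc n) = - (pochhammer (1 / 2) n / fact n) / (2 * real (Suc n))"
    unfolding root_coeff_def p by (simp add: field_simps)
  moreover have "x / f + - (x / f) / (2 * s) = x * (1 / 2 + m) / (s * f)"
    if "f \<noteq> 0" "s \<noteq> 0" "s = 1 + m" for x f s m :: real
    using that by (simp add: divide_simps) (simp add: algebra_simps)
  ultimately show ?case
    by (simp add: Suc pochhammer_Suc del: of_nat_Suc) simp
qed

text \<open>All terms have one sign, so the sum is 1 minus a partial sum of the coefficients, and
  those partial sums are nonnegative. This yields absolute convergence on the closed unit ball,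
  boundary included.\<close>

lemma sum_abs_root_coeff_Suc_le: "(\<Sum>k<n. \<bar>root_coeff (Suc k)\<bar>) \<le> 1"
proof -
  have "(\<Sum>k<n. \<bar>root_coeff (Suc k)\<bar>) = - (\<Sum>k<n. root_coeff (Suc k))"
    by (simp add: abs_of_nonpos root_coeff_Suc_nonpos sum_negf)
  also have "\<dots> = 1 - (\<Sum>k\<le>n. root_coeff k)"
    by (simp add: sum.atMost_shift)
  also have "\<dots> \<le> 1"
    unfolding sum_root_coeff by (simp add: pochhammer_nonneg)
  finally show ?thesis .
qed

lemma summable_abs_root_coeff_Suc: "summable (\<lambda>k. \<bar>root_coeff (Suc k)\<bar>)"
  by (rule summableI_nonneg_bounded[where x = 1]) (auto simp: sum_abs_root_coeff_Suc_le)

lemma summable_abs_root_coeff: "summable (\<lambda>k. \<bar>root_coeff k\<bar>)"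
  using summable_abs_root_coeff_Suc by (rule summable_Suc_iff[THEN iffD1])

text \<open>Chu-Vandermonde adds the two parameters \<open>- 1 / 2\<close> to \<open>- 1\<close>,
  and the rising factorial of \<open>- 1\<close> contains the factor 0 from \<open>n = 2\<close>
  on.\<close>

lemma root_coeff_convolution:
  "(\<Sum>i\<le>n. root_coeff i * root_coeff (n - i)) = (if n = 0 then 1 else if n = 1 then - 1 else 0)"
proof -
  have "(\<Sum>i\<le>n. root_coeff i * root_coeff (n - i))
      = (\<Sum>k\<le>n. of_nat (n choose k) * pochhammer (- 1 / 2) k * pochhammer (- 1 / 2) (n - k)) / fact n"
    unfolding sum_divide_distrib
    by (rule sum.cong) (simp_all add: root_coeff_def binomial_fact)
  also have "\<dots> = pochhammer (- 1 :: real) n / fact n"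
    using pochhammer_binomial_sum[of "- 1 / 2 :: real" "- 1 / 2" n] by simp
  also have "\<dots> = (if n = 0 then 1 else if n = 1 then - 1 else 0)"
    using pochhammer_of_nat_eq_0_lemma[of 1 n, where 'a = real] by auto
  finally show ?thesis .
qed

text \<open>The argument is the deviation from the unit: the root of \<open>y\<close> is written
  \<open>root_one_minus (1 - y)\<close> and is taken under
  \<open>norm (1 - y) \<le> 1\<close>.\<close>

definition root_one_minus :: "'a::{real_normed_algebra_1,banach} \<Rightarrow> 'a" where
  "root_one_minus z = (\<Sum>n. root_coeff n *\<^sub>R z ^ n)"

context
  fixes z :: "'a::{real_normed_algebra_1,banach}"
  assumes z: "norm z \<le> 1"
begin

lemma norm_root_term_le: "norm (root_coeff n *\<^sub>R z ^ n) \<le> \<bar>root_coeff n\<bar>"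
proof -
  have "norm (z ^ n) \<le> 1"
    by (meson norm_power_ineq order_trans power_le_one norm_ge_zero z)
  then show ?thesis
    by (simp add: mult_left_le)
qed

lemma summable_norm_root_terms: "summable (\<lambda>n. norm (root_coeff n *\<^sub>R z ^ n))"
  by (rule summable_comparison_test'[OF summable_abs_root_coeff, of 0])
    (use norm_root_term_le in simp)

lemma root_one_minus_sums: "(\<lambda>n. root_coeff n *\<^sub>R z ^ n) sums root_one_minus z"
  unfolding root_one_minus_def
  by (rule summable_sums[OF summable_norm_cancel[OF summable_norm_root_terms]])

lemma root_one_minus_sums_Suc:
  "(\<lambda>n. root_coeff (Suc n) *\<^sub>R z ^ Suc n) sums (root_one_minus z - 1)"
  using root_one_minus_sums by (subst sums_Suc_iff) simp

lemma root_one_minus_square: "root_one_minus z * root_one_minus z = 1 - z"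
proof -
  have "root_one_minus z * root_one_minus z
      = (\<Sum>k. \<Sum>i\<le>k. root_coeff i *\<^sub>R z ^ i * (root_coeff (k - i) *\<^sub>R z ^ (k - i)))"
    unfolding root_one_minus_def
    by (rule Cauchy_product[OF summable_norm_root_terms summable_norm_root_terms])
  also have "(\<lambda>k. \<Sum>i\<le>k. root_coeff i *\<^sub>R z ^ i * (root_coeff (k - i) *\<^sub>R z ^ (k - i)))
      = (\<lambda>k. (if k = 0 then 1 else if k = 1 then - 1 else 0) *\<^sub>R z ^ k)"
  proof
    fix k
    have "root_coeff i *\<^sub>R z ^ i * (root_coeff (k - i) *\<^sub>R z ^ (k - i))
        = (root_coeff i * root_coeff (k - i)) *\<^sub>R z ^ k" if "i \<le> k" for i
    proof -
      have "z ^ i * z ^ (k - i) = z ^ k"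
        using that by (metis power_add le_add_diff_inverse)
      then show ?thesis by (simp add: mult.commute)
    qed
    then have "(\<Sum>i\<le>k. root_coeff i *\<^sub>R z ^ i * (root_coeff (k - i) *\<^sub>R z ^ (k - i)))
        = (\<Sum>i\<le>k. root_coeff i * root_coeff (k - i)) *\<^sub>R z ^ k"
      unfolding scaleR_sum_left by (intro sum.cong) simp_all
    then show "(\<Sum>i\<le>k. root_coeff i *\<^sub>R z ^ i * (root_coeff (k - i) *\<^sub>R z ^ (k - i)))
        = (if k = 0 then 1 else if k = 1 then - 1 else 0) *\<^sub>R z ^ k"
      by (simp only: root_coeff_convolution)
  qed
  also have "suminf \<dots> = (\<Sum>k\<in>{0, 1}. (if k = 0 then 1 else if k = 1 then - 1 else 0) *\<^sub>R z ^ k)"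
    by (rule suminf_finite) auto
  finally show ?thesis by simp
qed

text \<open>The constant term is 1 and the other coefficients have total absolute value at most 1.
  Hence the series can be applied once more, to the root itself.\<close>

lemma norm_one_minus_root_le: "norm (1 - root_one_minus z) \<le> 1"
proof -
  have s: "summable (\<lambda>n. norm (root_coeff (Suc n) *\<^sub>R z ^ Suc n))"
    using summable_norm_root_terms by (rule summable_Suc_iff[THEN iffD2])
  have "norm (1 - root_one_minus z) = norm (\<Sum>n. root_coeff (Suc n) *\<^sub>R z ^ Suc n)"
    using root_one_minus_sums_Suc by (simp add: sums_iff norm_minus_commute)
  also have "\<dots> \<le> (\<Sum>n. \<bar>root_coeff (Suc n)\<bar>)"
    by (rule order_trans[OF summable_norm[OF s]], rule suminf_le)
      (use norm_root_term_le s summable_abs_root_coeff_Suc in blast)+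
  also have "\<dots> \<le> 1"
    by (rule suminf_le_const) (auto simp: summable_abs_root_coeff_Suc sum_abs_root_coeff_Suc_le)
  finally show ?thesis .
qed

lemma root_one_minus_commute:
  assumes "z * w = w * z"
  shows "root_one_minus z * w = w * root_one_minus z"
proof -
  have "z ^ n * w = w * z ^ n" for n
    using assms by (rule power_commuting_commutes)
  then have "(\<lambda>n. (root_coeff n *\<^sub>R z ^ n) * w) = (\<lambda>n. w * (root_coeff n *\<^sub>R z ^ n))"
    by auto
  then show ?thesis
    using sums_mult2[OF root_one_minus_sums, of w] sums_mult[OF root_one_minus_sums, of w]
    by (metis sums_unique2)
qed

end

lemma sums_in_closed_subspace:
  fixes V :: "'b::real_normed_vector set"
  assumes "subspace V" "closed V" "f sums s" "\<And>n. f n \<in> V"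
  shows "s \<in> V"
  using assms unfolding sums_def
  by (meson closed_sequentially subspace_sum)

section \<open>C*-algebras\<close>

lemma cscale_0_left [simp]: "cscale 0 (x::'a::cstar_alg) = 0"
  using cscale_add_left[of 0 0 x] by simp

lemma cscale_minus_one [simp]: "cscale (- 1) (x::'a::cstar_alg) = - x"
  using cscale_of_real[of "- 1" x] by simp

lemma cscale_0_right [simp]: "cscale c (0::'a::cstar_alg) = 0"
  using cscale_add_right[of c 0 "0::'a"] by simp

lemma cscale_minus_right: "cscale c (- x) = - cscale c (x::'a::cstar_alg)"
  using cscale_add_right[of c "- x" x] by (simp add: eq_neg_iff_add_eq_0)

lemma cscale_diff_right: "cscale c (x - y) = cscale c x - cscale c (y::'a::cstar_alg)"
  using cscale_add_right[of c x "- y"] by (simp add: cscale_minus_right)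

lemma cstar_0 [simp]: "cstar (0::'a::cstar_alg) = 0"
  using cstar_add[of 0 "0::'a"] by simp

lemma cstar_1 [simp]: "cstar (1::'a::cstar_alg) = 1"
  by (metis cstar_cstar cstar_mult mult.right_neutral)

lemma cstar_scaleR: "cstar (r *\<^sub>R x) = r *\<^sub>R cstar (x::'a::cstar_alg)"
  by (metis complex_cnj_complex_of_real cscale_of_real cstar_cscale)

lemma cstar_minus: "cstar (- x) = - cstar (x::'a::cstar_alg)"
  using cstar_scaleR[of "- 1" x] by simp

lemma cstar_diff: "cstar (x - y) = cstar x - cstar (y::'a::cstar_alg)"
  using cstar_add[of x "- y"] by (simp add: cstar_minus)

lemma cstar_power: "cstar (x ^ n) = cstar (x::'a::cstar_alg) ^ n"
  by (induction n) (simp_all add: cstar_mult power_commutes)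

lemma norm_cstar [simp]: "norm (cstar (x::'a::cstar_alg)) = norm x"
proof -
  have le: "norm y \<le> norm (cstar y)" for y :: 'a
  proof (cases "y = 0")
    case False
    have "norm y * norm y \<le> norm (cstar y) * norm y"
      by (metis cstar_identity norm_mult_ineq)
    with False show ?thesis by simp
  qed simp
  from le[of x] le[of "cstar x"] show ?thesis by (simp add: cstar_cstar)
qed

lemma bounded_linear_cstar: "bounded_linear (cstar :: 'a::cstar_alg \<Rightarrow> 'a)"
  by (rule bounded_linear_intro[where K = 1]) (simp_all add: cstar_add cstar_scaleR)

lemma norm_selfadjoint_square: "cstar x = x \<Longrightarrow> norm (x * x) = norm x * norm (x::'a::cstar_alg)"
  by (metis cstar_identity)

lemma cstar_root_one_minus:
  assumes "norm z \<le> 1" "cstar z = (z::'a::cstar_alg)"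
  shows "cstar (root_one_minus z) = root_one_minus z"
proof -
  have "(\<lambda>n. cstar (root_coeff n *\<^sub>R z ^ n)) sums cstar (root_one_minus z)"
    by (rule bounded_linear.sums[OF bounded_linear_cstar root_one_minus_sums[OF assms(1)]])
  then show ?thesis
    using root_one_minus_sums[OF assms(1)] sums_unique2
    by (auto simp: cstar_scaleR cstar_power assms(2))
qed

text \<open>The element \<open>a + \<i> b\<close> is normal and \<open>a\<close> is its real part.\<close>

lemma norm_le_two_squares:
  fixes a b :: "'a::cstar_alg"
  assumes "cstar a = a" "cstar b = b" "a * b = b * a"
  shows "norm a * norm a \<le> norm (a * a + b * b)"
proof -
  define u where "u = a + cscale \<i> b"
  have star_u: "cstar u = a - cscale \<i> b"
    using cscale_cscale[of "- 1" \<i> b] by (simp add: u_def cstar_add cstar_cscale assms)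
  have "cstar u * u = a * a + b * b"
    unfolding star_u unfolding u_def
    by (simp add: algebra_simps cscale_mult_left cscale_mult_right cscale_cscale cscale_diff_right assms)
  then have eq: "norm u * norm u = norm (a * a + b * b)"
    by (metis cstar_identity)
  have "2 *\<^sub>R a = u + cstar u"
    unfolding star_u unfolding u_def by (simp add: scaleR_2)
  then have "2 * norm a \<le> norm u + norm (cstar u)"
    by (metis norm_scaleR norm_triangle_ineq abs_numeral)
  then have "norm a \<le> norm u" by simp
  then show ?thesis
    unfolding eq[symmetric] by (intro mult_mono) auto
qed

text \<open>With \<open>c\<close> the root of \<open>1 - s * s\<close>, the commuting self-adjoint
  elements \<open>c\<close> and \<open>s\<close> satisfy \<open>c * c + s * s = 1\<close>, so
  \<open>norm c \<le> 1\<close>. The bound is what allows the series to form the root of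
  \<open>s * s\<close>.\<close>

lemma norm_one_minus_square_le:
  fixes s :: "'a::cstar_alg"
  assumes "norm s \<le> 1" "cstar s = s"
  shows "norm (1 - s * s) \<le> 1"
proof -
  define c where "c = root_one_minus (s * s)"
  have s2: "norm (s * s) \<le> 1"
    using assms by (metis norm_mult_ineq order_trans mult_le_one norm_ge_zero)
  have c: "cstar c = c" "c * s = s * c" "c * c = 1 - s * s"
  proof -
    show "cstar c = c" unfolding c_def
      by (rule cstar_root_one_minus[OF s2]) (simp add: cstar_mult assms)
    show "c * s = s * c" unfolding c_def
      by (rule root_one_minus_commute[OF s2]) (simp add: mult.assoc)
    show "c * c = 1 - s * s" unfolding c_def by (rule root_one_minus_square[OF s2])
  qed
  have "norm c * norm c \<le> norm (c * c + s * s)"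
    by (intro norm_le_two_squares c assms)
  then have "norm (c * c) \<le> 1"
    using norm_mult_ineq[of c c] by (simp add: c)
  then show ?thesis by (simp add: c)
qed

text \<open>Both \<open>y\<close> and the root \<open>r\<close> of \<open>y\<^sup>2\<close> are squares, \<open>r = p\<^sup>2\<close> and \<open>y = q\<^sup>2\<close>; with
  \<open>d = r - y\<close> this gives \<open>(d p)\<^sup>2 + (d q)\<^sup>2 = d\<^sup>2 (r + y) = 0\<close>.\<close>

lemma root_of_square:
  fixes y :: "'a::cstar_alg"
  assumes y: "cstar y = y" "norm y \<le> 1" and y1: "norm (1 - y) \<le> 1"
  shows "root_one_minus (1 - y * y) = y"
proof -
  define r where "r = root_one_minus (1 - y * y)"
  define p where "p = root_one_minus (1 - r)"
  define q where "q = root_one_minus (1 - y)"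
  define d where "d = r - y"
  have n: "norm (1 - y * y) \<le> 1" by (rule norm_one_minus_square_le[OF y(2,1)])
  have r: "cstar r = r" "r * y = y * r" "r * r = y * y" "norm (1 - r) \<le> 1"
  proof -
    show "cstar r = r" unfolding r_def
      by (rule cstar_root_one_minus[OF n]) (simp add: cstar_diff cstar_mult y)
    show "r * y = y * r" unfolding r_def
      by (rule root_one_minus_commute[OF n]) (simp add: algebra_simps)
    show "r * r = y * y" unfolding r_def by (simp add: root_one_minus_square[OF n])
    show "norm (1 - r) \<le> 1" unfolding r_def by (rule norm_one_minus_root_le[OF n])
  qed
  have q: "cstar q = q" "q * q = y" "q * r = r * q" "q * y = y * q"
  proof -
    show "cstar q = q" unfolding q_def
      by (rule cstar_root_one_minus[OF y1]) (simp add: cstar_diff y)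
    show "q * q = y" unfolding q_def by (simp add: root_one_minus_square[OF y1])
    show "q * r = r * q" unfolding q_def
      by (rule root_one_minus_commute[OF y1]) (simp add: algebra_simps r(2))
    show "q * y = y * q" unfolding q_def
      by (rule root_one_minus_commute[OF y1]) (simp add: algebra_simps)
  qed
  have p: "cstar p = p" "p * p = r" "p * r = r * p" "p * y = y * p" "p * q = q * p"
  proof -
    show "cstar p = p" unfolding p_def
      by (rule cstar_root_one_minus[OF r(4)]) (simp add: cstar_diff r(1))
    show "p * p = r" unfolding p_def by (simp add: root_one_minus_square[OF r(4)])
    show "p * r = r * p" unfolding p_def
      by (rule root_one_minus_commute[OF r(4)]) (simp add: algebra_simps)
    show "p * y = y * p" unfolding p_def
      by (rule root_one_minus_commute[OF r(4)]) (simp add: algebra_simps r(2))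
    show "p * q = q * p" unfolding p_def
      by (rule root_one_minus_commute[OF r(4)]) (simp add: algebra_simps q(3))
  qed
  have d: "cstar d = d" "p * d = d * p" "q * d = d * q"
    unfolding d_def by (simp_all add: cstar_diff r(1) y(1) left_diff_distrib right_diff_distrib p(3,4) q(3,4))
  have comm: "(d * p) * (d * q) = (d * q) * (d * p)"
    by (metis d(2,3) p(5) mult.assoc)
  have "(d * p) * (d * p) = d * (d * (p * p))" "(d * q) * (d * q) = d * (d * (q * q))"
    by (metis d(2) mult.assoc, metis d(3) mult.assoc)
  then have "(d * p) * (d * p) + (d * q) * (d * q) = d * (d * (r + y))"
    by (simp add: p(2) q(2) distrib_left)
  also have "d * (r + y) = 0"
    by (simp add: d_def r(2,3) left_diff_distrib distrib_left)
  finally have sum0: "(d * p) * (d * p) + (d * q) * (d * q) = 0" by simp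
  have sa: "cstar (d * p) = d * p" "cstar (d * q) = d * q"
    by (simp_all add: cstar_mult d p(1) q(1))
  have "norm (d * p) * norm (d * p) \<le> 0"
    using norm_le_two_squares[OF sa comm] by (simp add: sum0)
  then have dp: "d * p = 0"
    by (simp add: mult_le_0_iff)
  have "norm (d * q) * norm (d * q) \<le> 0"
    using norm_le_two_squares[OF sa(2,1) comm[symmetric]] sum0 by (simp add: add.commute)
  then have dq: "d * q = 0"
    by (simp add: mult_le_0_iff)
  \<comment> \<open>As \<open>p * p - q * q = d\<close>, the two vanishing products recover
    \<open>d * d\<close>; the C*-identity for the self-adjoint \<open>d\<close> then gives
    \<open>d = 0\<close>.\<close>
  have "d * d = (d * p) * p - (d * q) * q"
    by (simp add: mult.assoc p(2) q(2)) (simp add: d_def algebra_simps)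
  then have "norm d * norm d = 0"
    using norm_selfadjoint_square[OF d(1)] by (simp add: dp dq)
  then show ?thesis by (simp add: d_def r_def)
qed

section \<open>Closed ideals and subalgebras\<close>

lemma csubspace_subspace: "csubspace S \<Longrightarrow> subspace S"
  unfolding csubspace_def subspace_def by (metis cscale_of_real)

lemma closed_ideal_subspace: "closed_ideal J \<Longrightarrow> subspace J"
  by (simp add: closed_ideal_def csubspace_subspace)

lemma closed_ideal_multD:
  assumes "closed_ideal J" "j \<in> J"
  shows "a * j \<in> J" "j * a \<in> J"
  using assms by (auto simp: closed_ideal_def)

text \<open>Congruence modulo \<open>J\<close> is expressed by differences lying in
  \<open>J\<close>, which replaces computations in the quotient algebra.\<close>

lemma closed_ideal_cong_mult:
  assumes J: "closed_ideal J" and "a - b \<in> J" "c - d \<in> J"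
  shows "a * c - b * d \<in> J"
proof -
  have "a * c - b * d = (a - b) * c + b * (c - d)" by (simp add: algebra_simps)
  then show ?thesis
    using assms by (auto simp: closed_ideal_multD intro: subspace_add[OF closed_ideal_subspace[OF J]])
qed

lemma closed_ideal_cong_power:
  assumes J: "closed_ideal J" and "a - b \<in> J"
  shows "a ^ n - b ^ n \<in> J"
  by (induction n)
    (use assms in \<open>auto intro: closed_ideal_cong_mult subspace_0[OF closed_ideal_subspace]\<close>)

text \<open>The two series are congruent term by term, and \<open>J\<close> is closed.\<close>

lemma closed_ideal_cong_root:
  assumes J: "closed_ideal J" and "norm a \<le> 1" "norm b \<le> 1" "a - b \<in> J"
  shows "root_one_minus a - root_one_minus b \<in> J"
proof (rule sums_in_closed_subspace)
  show "subspace J" by (rule closed_ideal_subspace[OF J])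
  show "closed J" using J by (simp add: closed_ideal_def)
  show "(\<lambda>n. root_coeff n *\<^sub>R a ^ n - root_coeff n *\<^sub>R b ^ n)
      sums (root_one_minus a - root_one_minus b)"
    by (intro sums_diff root_one_minus_sums assms)
  show "root_coeff n *\<^sub>R a ^ n - root_coeff n *\<^sub>R b ^ n \<in> J" for n
    by (metis subspace_scale[OF closed_ideal_subspace[OF J]] scaleR_diff_right
        closed_ideal_cong_power[OF J assms(4)])
qed

text \<open>With \<open>s = j j\<^sup>*\<close> of norm at most one and \<open>c = (1 - s\<^sup>2)\<^sup>1\<^sup>/\<^sup>2\<close>, the unitary
  \<open>u = c + \<i> s\<close> is congruent to \<open>1\<close> modulo \<open>J\<close>, and so are the averages \<open>q\<close> of
  \<open>1, u\<^sup>2, u\<^sup>4, \<dots>\<close>. As \<open>2 \<i> s = u - u\<^sup>*\<close>, the products \<open>s q\<close> telescope and tend to \<open>0\<close>;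
  hence so do the elements \<open>j\<^sup>* q\<close>, which differ from \<open>j\<^sup>*\<close> by elements of \<open>J\<close>.\<close>

lemma closed_ideal_cstar_aux:
  fixes j :: "'a::cstar_alg"
  assumes J: "closed_ideal J" and j: "j \<in> J" and n1: "norm j \<le> 1" and e: "e > 0"
  shows "\<exists>k\<in>J. dist k (cstar j) < e"
proof -
  note sub = closed_ideal_subspace[OF J]
  define s where "s = j * cstar j"
  define c where "c = root_one_minus (s * s)"
  define u where "u = c + cscale \<i> s"
  have s: "cstar s = s" "s \<in> J"
    by (simp_all add: s_def cstar_mult cstar_cstar closed_ideal_multD[OF J j])
  have ns: "norm s \<le> 1"
    unfolding s_def using n1 by (metis norm_mult_ineq order_trans mult_le_one norm_ge_zero norm_cstar)
  have ns2: "norm (s * s) \<le> 1"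
    using ns by (metis norm_mult_ineq order_trans mult_le_one norm_ge_zero)
  have c: "cstar c = c" "c * s = s * c" "c * c = 1 - s * s"
  proof -
    show "cstar c = c" unfolding c_def
      by (rule cstar_root_one_minus[OF ns2]) (simp add: cstar_mult s)
    show "c * s = s * c" unfolding c_def
      by (rule root_one_minus_commute[OF ns2]) (simp add: mult.assoc)
    show "c * c = 1 - s * s" unfolding c_def by (rule root_one_minus_square[OF ns2])
  qed
  have "root_one_minus 0 = (1::'a)"
  proof -
    have "root_one_minus (1 - 1 * 1) = (1::'a)" by (rule root_of_square) auto
    then show ?thesis by simp
  qed
  moreover have "root_one_minus (s * s) - root_one_minus 0 \<in> J"
    by (rule closed_ideal_cong_root[OF J]) (simp_all add: ns2 closed_ideal_multD[OF J s(2)])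
  ultimately have c1: "c - 1 \<in> J" by (simp add: c_def)
  have star_u: "cstar u = c - cscale \<i> s"
    using cscale_cscale[of "- 1" \<i> s] by (simp add: u_def cstar_add cstar_cscale s c)
  have uu: "cstar u * u = 1"
    unfolding star_u unfolding u_def
    by (simp add: algebra_simps cscale_mult_left cscale_mult_right cscale_cscale cscale_diff_right c)
  have nu: "norm u = 1"
    using cstar_identity[of u] unfolding uu
    by (metis norm_ge_zero norm_one mult.right_neutral power2_eq_square power2_eq_iff_nonneg zero_le_one)
  have u1: "u - 1 \<in> J"
  proof -
    have "cscale \<i> s \<in> J" using J s by (simp add: closed_ideal_def csubspace_def)
    then have "(c - 1) + cscale \<i> s \<in> J" using c1 by (rule subspace_add[OF sub, rotated])
    then show ?thesis by (simp add: u_def algebra_simps)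
  qed
  \<comment> \<open>The final estimate bounds the square of \<open>norm (cstar j * q)\<close>, hence
    \<open>e * e\<close>.\<close>
  obtain N :: nat where N: "N > 0" "1 / real N < e * e"
  proof -
    obtain m where "inverse (real (Suc m)) < e * e"
      using reals_Archimedean[of "e * e"] e by auto
    then show ?thesis by (intro that[of "Suc m"]) (auto simp: inverse_eq_divide)
  qed
  define q where "q = (1 / real N) *\<^sub>R (\<Sum>k<N. (u * u) ^ k)"
  have norm_uu: "norm ((u * u) ^ k) \<le> 1" for k
  proof -
    have "norm ((u * u) ^ k) \<le> norm (u * u) ^ k" by (rule norm_power_ineq)
    also have "\<dots> \<le> 1"
      using norm_mult_ineq[of u u] by (intro power_le_one) (simp_all add: nu)
    finally show ?thesis .
  qed
  have nq: "norm q \<le> 1"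
  proof -
    have "norm (\<Sum>k<N. (u * u) ^ k) \<le> (\<Sum>k<N. 1)"
      by (rule sum_norm_le) (rule norm_uu)
    then show ?thesis using N by (simp add: q_def field_simps)
  qed
  have q1: "q - 1 \<in> J"
  proof -
    have "u * u - 1 * 1 \<in> J" by (rule closed_ideal_cong_mult[OF J u1 u1])
    then have "(u * u) ^ k - 1 ^ k \<in> J" for k
      by (intro closed_ideal_cong_power[OF J]) simp
    then have "(1 / real N) *\<^sub>R (\<Sum>k<N. (u * u) ^ k - 1) \<in> J"
      by (intro subspace_scale[OF sub] subspace_sum[OF sub]) simp
    moreover have "(1 / real N) *\<^sub>R (\<Sum>k<N. (u * u) ^ k - 1) = q - 1"
    proof -
      have "of_nat N = real N *\<^sub>R (1 :: 'a)" by (metis of_real_def of_real_of_nat_eq)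
      then show ?thesis using N by (simp add: q_def sum_subtractf scaleR_diff_right)
    qed
    ultimately show ?thesis by simp
  qed
  have sq: "norm (s * q) \<le> 1 / real N"
  proof -
    have cs: "cscale (2 * \<i>) s = u - cstar u"
      unfolding star_u unfolding u_def using cscale_add_left[of \<i> \<i> s]
      by (simp add: algebra_simps)
    have geometric: "(v - 1) * (\<Sum>k<n. v ^ k) = v ^ n - 1" for v :: 'a and n
      by (induction n) (simp_all add: algebra_simps)
    have "u - cstar u = cstar u * (u * u - 1)"
      by (simp add: right_diff_distrib uu flip: mult.assoc)
    then have "cscale (2 * \<i>) s * (\<Sum>k<N. (u * u) ^ k) = cstar u * ((u * u) ^ N - 1)"
      by (simp only: cs mult.assoc geometric)
    also have "norm \<dots> \<le> norm (cstar u) * norm ((u * u) ^ N - 1)" by (rule norm_mult_ineq)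
    also have "\<dots> \<le> 2"
      using norm_triangle_ineq4[of "(u * u) ^ N" 1] norm_uu[of N] by (simp add: nu)
    finally have "norm (s * (\<Sum>k<N. (u * u) ^ k)) \<le> 1"
      by (simp add: cscale_mult_left norm_cscale norm_mult)
    then show ?thesis using N by (simp add: q_def field_simps)
  qed
  \<comment> \<open>The C*-identity turns the square into the norm of
    \<open>cstar q * (j * cstar j) * q\<close>, where the small product \<open>s * q\<close>
    appears.\<close>
  have "norm (cstar j * q) * norm (cstar j * q) = norm (cstar q * (s * q))"
    using cstar_identity[of "cstar j * q"]
    by (simp add: cstar_mult cstar_cstar s_def mult.assoc)
  also have "\<dots> \<le> norm (cstar q) * norm (s * q)" by (rule norm_mult_ineq)
  also have "\<dots> \<le> 1 * (1 / real N)" by (rule mult_mono) (use nq sq in auto)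
  also have "\<dots> < e * e" using N by simp
  finally have "norm (cstar j * q) < e"
    using e by (meson mult_mono not_le less_imp_le order_trans norm_ge_zero linorder_not_less)
  moreover have "dist (cstar j * (1 - q)) (cstar j) = norm (cstar j * q)"
    by (simp add: dist_norm algebra_simps)
  \<comment> \<open>Membership comes from the factor \<open>1 - q\<close>; \<open>cstar j\<close>
    enters only as a multiplier from the algebra.\<close>
  moreover have "cstar j * (1 - q) \<in> J"
    using q1 subspace_neg[OF sub, of "q - 1"] by (auto intro: closed_ideal_multD[OF J])
  ultimately show ?thesis by metis
qed

text \<open>After rescaling to norm one, the preceding lemma puts the adjoint in the closure of
  \<open>J\<close>, which is \<open>J\<close>.\<close>

lemma closed_ideal_cstar:
  assumes J: "closed_ideal J" and j: "j \<in> J"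
  shows "cstar j \<in> J"
proof (cases "j = 0")
  case False
  define k where "k = (1 / norm j) *\<^sub>R j"
  have k: "k \<in> J" "norm k \<le> 1" "j = norm j *\<^sub>R k"
    using False j by (simp_all add: k_def subspace_scale[OF closed_ideal_subspace[OF J]])
  have "cstar k \<in> closure J"
    unfolding closure_approachable using closed_ideal_cstar_aux[OF J k(1,2)] by blast
  then have "cstar k \<in> J" using J by (simp add: closed_ideal_def)
  then have "norm j *\<^sub>R cstar k \<in> J" by (rule subspace_scale[OF closed_ideal_subspace[OF J]])
  then show ?thesis by (metis k(3) cstar_scaleR)
qed (use j in simp)

text \<open>An algebraic notion without closedness, so that \<open>setsum C J\<close> can be shown
  to satisfy it without proving that the sum is closed.\<close>

definition unital_star_subalgebra :: "'a::cstar_alg set \<Rightarrow> bool" where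
  "unital_star_subalgebra D \<longleftrightarrow> csubspace D \<and> 1 \<in> D \<and> (\<forall>x\<in>D. \<forall>y\<in>D. x * y \<in> D)
      \<and> (\<forall>x\<in>D. cstar x \<in> D)"

lemma unital_star_subalgebra_subspace: "unital_star_subalgebra D \<Longrightarrow> subspace D"
  by (simp add: unital_star_subalgebra_def csubspace_subspace)

lemma setsum_iff: "a \<in> setsum C J \<longleftrightarrow> (\<exists>c\<in>C. \<exists>j\<in>J. a = c + j)"
  by (auto simp: setsum_def)

lemma unital_star_subalgebra_setsum:
  assumes C: "unital_star_subalgebra C" and J: "closed_ideal J"
  shows "unital_star_subalgebra (setsum C J)"
proof -
  have C': "csubspace C" "1 \<in> C" "\<And>x y. x \<in> C \<Longrightarrow> y \<in> C \<Longrightarrow> x * y \<in> C" "\<And>x. x \<in> C \<Longrightarrow> cstar x \<in> C"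
    using C by (auto simp: unital_star_subalgebra_def)
  have J': "csubspace J" using J by (simp add: closed_ideal_def)
  have 1: "a + b \<in> setsum C J" if ab: "a \<in> setsum C J" "b \<in> setsum C J" for a b
  proof -
    obtain c j c' j' where "c \<in> C" "j \<in> J" "a = c + j" "c' \<in> C" "j' \<in> J" "b = c' + j'"
      using ab by (auto simp: setsum_iff)
    then show ?thesis
      using C'(1) J' unfolding setsum_iff csubspace_def
      by (intro bexI[of _ "c + c'"] bexI[of _ "j + j'"]) auto
  qed
  have 2: "a * b \<in> setsum C J" if ab: "a \<in> setsum C J" "b \<in> setsum C J" for a b
  proof -
    obtain c j c' j' where h: "c \<in> C" "j \<in> J" "a = c + j" "c' \<in> C" "j' \<in> J" "b = c' + j'"
      using ab by (auto simp: setsum_iff)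
    have "a * b - c * c' \<in> J"
      by (rule closed_ideal_cong_mult[OF J]) (simp_all add: h)
    then show ?thesis
      unfolding setsum_iff using C'(3)[OF h(1,4)] by (metis add.commute diff_add_cancel)
  qed
  have 3: "cstar a \<in> setsum C J" if a: "a \<in> setsum C J" for a
    using a C' closed_ideal_cstar[OF J] by (fastforce simp: setsum_iff cstar_add)
  have 4: "cscale l a \<in> setsum C J" if a: "a \<in> setsum C J" for a l
    using a C'(1) J' by (fastforce simp: setsum_iff cscale_add_right csubspace_def)
  have 5: "0 \<in> setsum C J" "1 \<in> setsum C J"
    unfolding setsum_iff
    by (rule bexI[of _ 0], rule bexI[of _ 0], use C'(1) J' in \<open>simp_all add: csubspace_def\<close>)
      (rule bexI[of _ 1], rule bexI[of _ 0], use C'(2) J' in \<open>simp_all add: csubspace_def\<close>)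
  show ?thesis
    unfolding unital_star_subalgebra_def csubspace_def
    by (intro conjI ballI allI 1 2 3 4 5)
qed

lemma unital_star_subalgebra_scalars:
  "unital_star_subalgebra (range (\<lambda>l. cscale l (1::'a::cstar_alg)))"
proof -
  let ?S = "range (\<lambda>l. cscale l (1::'a))"
  have "0 \<in> ?S" "1 \<in> ?S"
    by (rule range_eqI[of _ _ 0], simp) (rule range_eqI[of _ _ 1], simp add: cscale_one)
  moreover have "x + y \<in> ?S" and "x * y \<in> ?S" if "x \<in> ?S" "y \<in> ?S" for x y
    using that
    by (auto simp: cscale_cscale cscale_mult_left simp flip: cscale_add_left)
  moreover have "cscale c x \<in> ?S" "cstar x \<in> ?S" if "x \<in> ?S" for c x
    using that by (auto simp: cscale_cscale cstar_cscale)
  ultimately show ?thesis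
    unfolding unital_star_subalgebra_def csubspace_def by (intro conjI ballI allI)
qed

text \<open>Lets \<open>unital_star_subalgebra_setsum\<close> serve for the lower right corner as
  well as for the upper left one.\<close>

lemma unitize_eq_setsum: "unitize (J :: 'a::cstar_alg set) = setsum (range (\<lambda>l. cscale l 1)) J"
proof (rule set_eqI)
  fix a :: 'a
  have "a \<in> unitize J \<longleftrightarrow> (\<exists>l. \<exists>j\<in>J. a = cscale l 1 + j)"
    unfolding unitize_def mem_Collect_eq by (metis add.commute)
  then show "a \<in> unitize J \<longleftrightarrow> a \<in> setsum (range (\<lambda>l. cscale l 1)) J"
    by (simp add: setsum_iff)
qed

lemma cstar_subalgebra_cstar_gen: "cstar_subalgebra (cstar_gen X)"
  unfolding cstar_subalgebra_def csubspace_def cstar_gen_def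
  by (auto intro!: closed_Inter)

lemma subset_cstar_gen: "X \<subseteq> cstar_gen X"
  by (auto simp: cstar_gen_def)

text \<open>Writing \<open>y = e + j\<close>, the element \<open>y = (y\<^sup>2)\<^sup>1\<^sup>/\<^sup>2\<close> is congruent modulo \<open>J\<close> to \<open>\<bar>e\<bar>\<close>,
  and the square root series converges at both elements after rescaling.\<close>

lemma setsum_root:
  fixes y :: "'a::cstar_alg"
  assumes C: "cstar_subalgebra C" "1 \<in> C" and J: "closed_ideal J"
    and yD: "y \<in> setsum C J" and y: "cstar y = y" and y1: "norm (1 - y) \<le> 1"
  shows "\<exists>g\<in>setsum C J. cstar g = g \<and> g * g = y"
proof -
  have subC: "subspace C" using C by (simp add: cstar_subalgebra_def csubspace_subspace)
  note subJ = closed_ideal_subspace[OF J]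
  have multC: "a * b \<in> C" if "a \<in> C" "b \<in> C" for a b using C that by (simp add: cstar_subalgebra_def)
  have rootC: "root_one_minus a \<in> C" if a: "a \<in> C" "norm a \<le> 1" for a
  proof (rule sums_in_closed_subspace[OF subC _ root_one_minus_sums[OF a(2)]])
    show "closed C" using C by (simp add: cstar_subalgebra_def)
    have "a ^ n \<in> C" for n by (induction n) (auto simp: C a multC)
    then show "root_coeff n *\<^sub>R a ^ n \<in> C" for n by (intro subspace_scale[OF subC])
  qed
  obtain e' j where ej: "e' \<in> C" "j \<in> J" "y = e' + j" using yD by (auto simp: setsum_iff)
  \<comment> \<open>Since \<open>y\<close> is self-adjoint and \<open>J\<close> is closed under
    adjoints, the component in \<open>C\<close> may be replaced by its real part.\<close>
  define e where "e = (1 / 2) *\<^sub>R (e' + cstar e')"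
  have "cstar e' \<in> C" using C ej by (simp add: cstar_subalgebra_def)
  then have e: "e \<in> C"
    unfolding e_def using ej(1) by (intro subspace_scale[OF subC] subspace_add[OF subC])
  have star_e: "cstar e = e"
    unfolding e_def cstar_scaleR cstar_add cstar_cstar by (simp only: add.commute)
  have ye: "y - e \<in> J"
  proof -
    have "(1 / 2) *\<^sub>R (y + cstar y) = e + (1 / 2) *\<^sub>R (j + cstar j)"
      unfolding e_def ej(3) cstar_add by (simp add: scaleR_add_right)
    then have "y - e = (1 / 2) *\<^sub>R (j + cstar j)"
      by (simp add: y)
    then show ?thesis
      using ej(2) closed_ideal_cstar[OF J]
      by (auto intro!: subspace_scale[OF subJ] subspace_add[OF subJ])
  qed
  \<comment> \<open>Dividing by \<open>M\<close> brings both \<open>y\<close> and \<open>e\<close>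
    into the unit ball, so that their squares have roots; \<open>1 - y0\<close> is a convex
    combination of \<open>1\<close> and \<open>1 - y\<close> and stays in the ball.\<close>
  define M where "M = 1 + norm e + norm y"
  define y0 where "y0 = (1 / M) *\<^sub>R y"
  define e0 where "e0 = (1 / M) *\<^sub>R e"
  have M: "M \<ge> 1" "norm e \<le> M" "norm y \<le> M" by (auto simp: M_def)
  have n: "norm y0 \<le> 1" "norm e0 \<le> 1" using M by (simp_all add: y0_def e0_def)
  have sa: "cstar y0 = y0" "cstar e0 = e0" by (simp_all add: y0_def e0_def cstar_scaleR y star_e)
  have e0C: "e0 \<in> C" unfolding e0_def using e by (intro subspace_scale[OF subC])
  have d0: "y0 - e0 \<in> J"
    unfolding y0_def e0_def scaleR_diff_right[symmetric] using ye by (rule subspace_scale[OF subJ])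
  have y01: "norm (1 - y0) \<le> 1"
  proof -
    have "1 - y0 = (1 - 1 / M) *\<^sub>R 1 + (1 / M) *\<^sub>R (1 - y)"
      by (simp add: y0_def algebra_simps)
    also have "norm \<dots> \<le> (1 - 1 / M) + (1 / M) * norm (1 - y)"
      using M by (intro order_trans[OF norm_triangle_ineq]) simp
    also have "\<dots> \<le> (1 - 1 / M) + (1 / M) * 1"
      using M y1 by (intro add_left_mono mult_left_mono) auto
    finally show ?thesis by simp
  qed
  \<comment> \<open>\<open>e0\<close> need not be positive, so \<open>norm (1 - e0)\<close> may
    exceed 1. Its absolute value \<open>r\<close> lies in \<open>C\<close>, satisfies the norm
    condition and is still congruent to \<open>y0\<close>.\<close>
  define r where "r = root_one_minus (1 - e0 * e0)"
  have ne: "norm (1 - e0 * e0) \<le> 1" "norm (1 - y0 * y0) \<le> 1"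
    by (intro norm_one_minus_square_le n sa)+
  have rC: "r \<in> C" unfolding r_def
    by (intro rootC ne subspace_diff[OF subC] C multC e0C)
  have "root_one_minus (1 - y0 * y0) - r \<in> J" unfolding r_def
  proof (rule closed_ideal_cong_root[OF J ne(2,1)])
    have "e0 - y0 \<in> J" using subspace_neg[OF subJ d0] by simp
    then show "1 - y0 * y0 - (1 - e0 * e0) \<in> J"
      using closed_ideal_cong_mult[OF J, of e0 y0 e0 y0] by (simp add: algebra_simps)
  qed
  then have yr: "y0 - r \<in> J" by (simp add: root_of_square[OF sa(1) n(1) y01])
  have r1: "norm (1 - r) \<le> 1" unfolding r_def by (rule norm_one_minus_root_le[OF ne(1)])
  define g where "g = root_one_minus (1 - y0)"
  have "root_one_minus (1 - r) \<in> C" by (intro rootC r1 subspace_diff[OF subC] C rC)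
  moreover have "g - root_one_minus (1 - r) \<in> J" unfolding g_def
    using subspace_neg[OF subJ yr] by (intro closed_ideal_cong_root[OF J] y01 r1) simp
  \<comment> \<open>The factor \<open>sqrt M\<close> undoes the rescaling, because
    \<open>g * g = y0\<close>.\<close>
  moreover have "sqrt M *\<^sub>R g = sqrt M *\<^sub>R root_one_minus (1 - r) + sqrt M *\<^sub>R (g - root_one_minus (1 - r))"
    by (simp add: scaleR_diff_right)
  ultimately have gD: "sqrt M *\<^sub>R g \<in> setsum C J"
    unfolding setsum_iff using subspace_scale[OF subC] subspace_scale[OF subJ] by blast
  have "cstar g = g" unfolding g_def
    by (rule cstar_root_one_minus[OF y01]) (simp add: cstar_diff sa)
  moreover have "g * g = y0" unfolding g_def by (simp add: root_one_minus_square[OF y01])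
  ultimately show ?thesis
    using M by (intro bexI[OF _ gD]) (auto simp: cstar_scaleR y0_def)
qed

section \<open>Completely positive maps\<close>

lemma hscale_0_left [simp]: "hscale 0 (x::'h::chilbert) = 0"
  using hscale_add_left[of 0 0 x] by simp

lemma cinner_0_left [simp]: "cinner (0::'h::chilbert) x = 0"
  using cinner_add_left[of 0 "0::'h" x] by simp

lemma cinner_add_right: "cinner x (y + z) = cinner x y + cinner x (z::'h::chilbert)"
  by (metis cinner_commute cinner_add_left complex_cnj_add)

lemma cinner_hscale_right: "cinner x (hscale c y) = cnj c * cinner x (y::'h::chilbert)"
  by (metis cinner_commute cinner_hscale_left complex_cnj_mult)

lemma cinner_0_right [simp]: "cinner x (0::'h::chilbert) = 0"
  using cinner_add_right[of x 0 "0::'h"] by simp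

lemma cinner_sum_left: "cinner (\<Sum>i\<in>I. f i) (y::'h::chilbert) = (\<Sum>i\<in>I. cinner (f i) y)"
  by (induction I rule: infinite_finite_induct) (simp_all add: cinner_add_left)

lemma cinner_sum_right: "cinner y (\<Sum>i\<in>I. f i) = (\<Sum>i\<in>I. cinner y (f i :: 'h::chilbert))"
  by (induction I rule: infinite_finite_induct) (simp_all add: cinner_add_right)

lemma Im_cinner_self [simp]: "Im (cinner x (x::'h::chilbert)) = 0"
  and Re_cinner_self_nonneg [simp]: "0 \<le> Re (cinner x x)"
  using cinner_self_nonneg by auto

lemma hnorm_nonneg [simp]: "0 \<le> hnorm x"
  by (simp add: hnorm_def)

lemma hnorm_hscale: "hnorm (hscale c x) = cmod c * hnorm x"
proof -
  have "cinner (hscale c x) (hscale c x) = of_real ((cmod c)\<^sup>2) * cinner x x"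
    unfolding complex_norm_square cinner_hscale_left cinner_hscale_right by simp
  then show ?thesis
    by (simp add: hnorm_def real_sqrt_mult)
qed

text \<open>A crude triangle inequality obtained without Cauchy-Schwarz, from the nonnegativity of
  the squared norm of \<open>x - y\<close>. It suffices for boundedness of sums of
  operators.\<close>

lemma hnorm_add_le: "hnorm (x + y) \<le> 2 * (hnorm x + hnorm y)"
proof -
  have "0 \<le> Re (cinner (x + hscale (- 1) y) (x + hscale (- 1) y))"
    by (rule Re_cinner_self_nonneg)
  then have "Re (cinner (x + y) (x + y)) \<le> 2 * Re (cinner x x) + 2 * Re (cinner y y)"
    by (simp add: cinner_add_left cinner_add_right cinner_hscale_left cinner_hscale_right)
  also have "\<dots> = 2 * (hnorm x)\<^sup>2 + 2 * (hnorm y)\<^sup>2"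
    by (simp add: hnorm_def)
  also have "\<dots> \<le> (2 * (hnorm x + hnorm y))\<^sup>2"
    by (simp add: power2_eq_square algebra_simps)
  finally show ?thesis
    unfolding hnorm_def[of "x + y"] by (intro real_le_lsqrt) simp_all
qed

lemma bop_add:
  assumes "bop S" "bop T"
  shows "bop (\<lambda>x. S x + T x)"
proof -
  obtain K L where "\<And>x. hnorm (S x) \<le> K * hnorm x" "\<And>x. hnorm (T x) \<le> L * hnorm x"
    using assms unfolding bop_def by blast
  then have "hnorm (S x + T x) \<le> (2 * (K + L)) * hnorm x" for x
    using hnorm_add_le[of "S x" "T x"] by (smt (verit) distrib_right mult.assoc)
  then have "\<exists>M. \<forall>x. hnorm (S x + T x) \<le> M * hnorm x" by blast
  then show ?thesis
    using assms by (simp add: bop_def hscale_add_right add_ac)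
qed

lemma lin_map_on_sum:
  assumes D: "csubspace D" and \<psi>: "lin_map_on (+) cscale D \<psi>" and f: "\<And>i. i \<in> I \<Longrightarrow> f i \<in> D"
  shows "\<psi> (\<Sum>i\<in>I. f i) x = (\<Sum>i\<in>I. \<psi> (f i) x)"
proof -
  have "\<psi> (cscale 0 0) = (\<lambda>x. hscale 0 (\<psi> 0 x))"
    using D \<psi> unfolding lin_map_on_def csubspace_def by blast
  then have zero: "\<psi> 0 x = 0" by (metis cscale_0_left hscale_0_left)
  show ?thesis
    using f
  proof (induction I rule: infinite_finite_induct)
    case (insert i I)
    have "(\<Sum>i\<in>I. f i) \<in> D"
      using insert by (intro subspace_sum[OF csubspace_subspace[OF D]]) auto
    then show ?case
      using insert \<psi> by (simp add: lin_map_on_def)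
  qed (simp_all add: zero)
qed

section \<open>Positive operator matrices and complete positivity\<close>

lemma pos_opmatI:
  assumes "\<And>i j x y. i < n \<Longrightarrow> j < n \<Longrightarrow>
    cinner (T i j x) y = (\<Sum>k<m. cinner (R k j x) (R k i y))"
  shows "pos_opmat n T"
proof -
  have "(\<Sum>i<n. \<Sum>j<n. cinner (T i j (\<xi> j)) (\<xi> i))
      = (\<Sum>k<m. cinner (\<Sum>j<n. R k j (\<xi> j)) (\<Sum>i<n. R k i (\<xi> i)))" for \<xi>
  proof -
    have "(\<Sum>i<n. \<Sum>j<n. cinner (T i j (\<xi> j)) (\<xi> i))
        = (\<Sum>i<n. \<Sum>j<n. \<Sum>k<m. cinner (R k j (\<xi> j)) (R k i (\<xi> i)))"
      by (intro sum.cong refl) (simp add: assms)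
    also have "\<dots> = (\<Sum>i<n. \<Sum>k<m. \<Sum>j<n. cinner (R k j (\<xi> j)) (R k i (\<xi> i)))"
      by (rule sum.cong[OF refl], rule sum.swap)
    also have "\<dots> = (\<Sum>k<m. \<Sum>i<n. \<Sum>j<n. cinner (R k j (\<xi> j)) (R k i (\<xi> i)))"
      by (rule sum.swap)
    finally show ?thesis
      by (simp add: cinner_sum_left cinner_sum_right)
  qed
  then show ?thesis
    unfolding pos_opmat_def by (simp add: sum_nonneg)
qed

lemma pos_opmat_add:
  assumes "pos_opmat n S" "pos_opmat n T"
    and "\<And>i j x. i < n \<Longrightarrow> j < n \<Longrightarrow> U i j x = S i j x + T i j x"
  shows "pos_opmat n U"
  using assms unfolding pos_opmat_def
  by (simp add: cinner_add_left sum.distrib)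

lemma star_rep_comp_pos:
  assumes D: "unital_star_subalgebra D" and \<rho>: "star_rep_A D \<rho>"
  shows "comp_pos (pos_mat_A D) D \<rho>"
  unfolding comp_pos_def
proof (intro allI impI, elim conjE)
  fix n F
  assume "pos_mat_A D n F"
  then obtain G where G: "\<And>i j. i < n \<Longrightarrow> j < n \<Longrightarrow> G i j \<in> D"
    and F: "\<And>i j. i < n \<Longrightarrow> j < n \<Longrightarrow> F i j = (\<Sum>k<n. cstar (G k i) * G k j)"
    unfolding pos_mat_A_def mprod_def madj_def by blast
  have D': "csubspace D" "\<And>x y. x \<in> D \<Longrightarrow> y \<in> D \<Longrightarrow> x * y \<in> D" "\<And>x. x \<in> D \<Longrightarrow> cstar x \<in> D"
    using D by (auto simp: unital_star_subalgebra_def)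
  have lin: "lin_map_on (+) cscale D \<rho>" using \<rho> by (simp add: star_rep_def)
  have mult: "cinner (\<rho> (cstar a * b) x) y = cinner (\<rho> b x) (\<rho> a y)" if "a \<in> D" "b \<in> D" for a b x y
    using \<rho> that D'(3) by (simp add: star_rep_def)
  show "pos_opmat n (\<lambda>i j. \<rho> (F i j))"
  proof (rule pos_opmatI)
    fix i j x y assume ij: "i < n" "j < n"
    have "\<rho> (F i j) x = (\<Sum>k<n. \<rho> (cstar (G k i) * G k j) x)"
      unfolding F[OF ij] by (rule lin_map_on_sum[OF D'(1) lin]) (simp add: D' G ij)
    then show "cinner (\<rho> (F i j) x) y = (\<Sum>k<n. cinner (\<rho> (G k j) x) (\<rho> (G k i) y))"
      by (simp add: cinner_sum_left mult G ij)
  qed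
qed

text \<open>A diagonal corner of a positive matrix over the two by two matrices is a sum of two Gram
  matrices, one from each row of the blocks. Complete positivity applies to each summand, and the
  forms add up.\<close>

lemma comp_pos_two_squares:
  assumes D: "unital_star_subalgebra D" and lin: "lin_map_on (+) cscale D \<psi>"
    and cp: "comp_pos (pos_mat_A D) D \<psi>"
    and PQ: "\<And>i j. i < n \<Longrightarrow> j < n \<Longrightarrow> P i j \<in> D \<and> Q i j \<in> D"
    and F: "\<And>i j. i < n \<Longrightarrow> j < n \<Longrightarrow>
      F i j = (\<Sum>k<n. cstar (P k i) * P k j) + (\<Sum>k<n. cstar (Q k i) * Q k j)"
  shows "pos_opmat n (\<lambda>i j. \<psi> (F i j))"
proof -
  have D': "csubspace D" "\<And>x y. x \<in> D \<Longrightarrow> y \<in> D \<Longrightarrow> x * y \<in> D" "\<And>x. x \<in> D \<Longrightarrow> cstar x \<in> D"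
    using D by (auto simp: unital_star_subalgebra_def)
  have mem: "(\<Sum>k<n. cstar (R k i) * R k j) \<in> D"
    if "\<And>i j. i < n \<Longrightarrow> j < n \<Longrightarrow> R i j \<in> D" "i < n" "j < n" for R i j
    using that by (intro subspace_sum[OF csubspace_subspace[OF D'(1)]] D') auto
  have pos: "pos_opmat n (\<lambda>i j. \<psi> (\<Sum>k<n. cstar (R k i) * R k j))"
    if "\<And>i j. i < n \<Longrightarrow> j < n \<Longrightarrow> R i j \<in> D" for R
  proof -
    have "pos_mat_A D n (\<lambda>i j. \<Sum>k<n. cstar (R k i) * R k j)"
      unfolding pos_mat_A_def mprod_def madj_def using that by (intro exI[of _ R]) simp
    then show ?thesis
      using cp[unfolded comp_pos_def, rule_format] mem[of R, OF that] by simp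
  qed
  show ?thesis
    by (rule pos_opmat_add[OF pos[of P] pos[of Q]])
      (use PQ F mem[of P] mem[of Q] lin in \<open>simp_all add: lin_map_on_def\<close>)
qed

text \<open>For \<open>\<parallel>a\<parallel> \<le> 1\<close> the matrix \<open>[1 a; a\<^sup>* 1]\<close> factors as \<open>G\<^sup>* G\<close> with \<open>G = [1 a; 0 g]\<close> and
  \<open>g\<^sup>2 = 1 - a\<^sup>* a\<close>; the quadratic form of its image is evaluated at \<open>(- \<psi>(a) y, y)\<close>.\<close>

lemma comp_pos_contractive:
  assumes C: "cstar_subalgebra C" "1 \<in> C" and J: "closed_ideal J"
    and lin: "lin_map_on (+) cscale (setsum C J) \<psi>"
    and cp: "comp_pos (pos_mat_A (setsum C J)) (setsum C J) \<psi>"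
    and one: "\<And>x. Re (cinner (\<psi> 1 x) x) \<le> Re (cinner x x)"
    and a: "a \<in> setsum C J"
  shows "hnorm (\<psi> a x) \<le> norm a * hnorm x"
proof -
  define D where "D = setsum C J"
  have usC: "unital_star_subalgebra C"
    using C by (simp add: unital_star_subalgebra_def cstar_subalgebra_def)
  have D: "unital_star_subalgebra D"
    unfolding D_def by (rule unital_star_subalgebra_setsum[OF usC J])
  then have D': "csubspace D" "1 \<in> D" "0 \<in> D" "\<And>x y. x \<in> D \<Longrightarrow> y \<in> D \<Longrightarrow> x * y \<in> D"
    "\<And>x. x \<in> D \<Longrightarrow> cstar x \<in> D"
    by (auto simp: unital_star_subalgebra_def csubspace_def)
  note subD = csubspace_subspace[OF D'(1)]
  have lin': "\<psi> (cscale c b) y = hscale c (\<psi> b y)" "bop (\<psi> b)" if "b \<in> D" for b c y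
    using lin that by (simp_all add: lin_map_on_def D_def)
  have unit_ball: "hnorm (\<psi> b y) \<le> hnorm y" if b: "b \<in> D" "norm b \<le> 1" for b y
  proof -
    have "norm (1 - (1 - cstar b * b)) \<le> 1"
      using b by (simp add: cstar_identity mult_le_one)
    moreover have "1 - cstar b * b \<in> setsum C J"
      unfolding D_def[symmetric] using b by (intro subspace_diff[OF subD] D')
    moreover have "cstar (1 - cstar b * b) = 1 - cstar b * b"
      by (simp add: cstar_diff cstar_mult cstar_cstar)
    ultimately obtain g where g: "g \<in> D" "cstar g = g" "g * g = 1 - cstar b * b"
      using setsum_root[OF C J, of "1 - cstar b * b"] unfolding D_def by blast
    define G where "G i j = (if i = 0 then if j = 0 then 1 else b else if j = 0 then 0 else g)" for i j :: nat
    define F where "F i j = (if i = 0 then if j = 0 then 1 else b else if j = 0 then cstar b else 1)" for i j :: nat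
    have "\<forall>i<2. \<forall>j<2. F i j = mprod 2 (madj G) G i j"
      by (auto simp: F_def G_def mprod_def madj_def numeral_2_eq_2 less_Suc_eq g(2,3))
    moreover have "\<forall>i<2. \<forall>j<2. G i j \<in> D" by (auto simp: G_def b g D')
    ultimately have "pos_mat_A D 2 F" unfolding pos_mat_A_def by blast
    moreover have "\<forall>i<2. \<forall>j<2. F i j \<in> D" by (auto simp: F_def b D')
    ultimately have pos: "pos_opmat 2 (\<lambda>i j. \<psi> (F i j))"
      using cp unfolding comp_pos_def D_def by blast
    \<comment> \<open>The quadratic form of the image of \<open>[1 b; cstar b 1]\<close> at the
      vector \<open>(v, w)\<close>.\<close>
    define Q where "Q v w = cinner (\<psi> 1 v) v + cinner (\<psi> b w) v + (cinner (\<psi> (cstar b) v) w + cinner (\<psi> 1 w) w)" for v w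
    have Q: "Im (Q v w) = 0" "0 \<le> Re (Q v w)" for v w
      using pos[unfolded pos_opmat_def, rule_format, of "\<lambda>i. if i = 0 then v else w"]
      by (simp_all add: Q_def F_def numeral_2_eq_2)
    have hom: "\<psi> d (hscale c v) = hscale c (\<psi> d v)" if "d \<in> D" for d c v
      using lin'(2)[OF that] by (simp add: bop_def)
    have z0: "\<psi> d 0 = 0" if "d \<in> D" for d
      using hom[OF that, of 0 0] by simp
    have Im1: "Im (cinner (\<psi> 1 v) v) = 0" for v
      using Q(1)[of v 0] by (simp add: Q_def z0 b D')
    \<comment> \<open>The form is real at \<open>(v, hscale \<i> w)\<close> too; there the imaginary
      part of the cross terms is the difference of these two real parts.\<close>
    have adj: "Re (cinner (\<psi> (cstar b) v) w) = Re (cinner (\<psi> b w) v)" for v w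
      using Q(1)[of v "hscale \<i> w"] Im1
      by (simp add: Q_def hom b D' cinner_hscale_left cinner_hscale_right)
    define z where "z = \<psi> b y"
    have "0 \<le> Re (Q (hscale (- 1) z) y)" by (rule Q(2))
    also have "\<dots> = Re (cinner (\<psi> 1 z) z) - 2 * Re (cinner z z) + Re (cinner (\<psi> 1 y) y)"
      unfolding Q_def
      by (simp add: adj hom D' b cinner_hscale_left cinner_hscale_right flip: z_def)
    also have "\<dots> \<le> Re (cinner y y) - Re (cinner z z)"
      using one[of z] one[of y] by simp
    finally show ?thesis
      by (simp add: hnorm_def z_def)
  qed
  show ?thesis
  proof (cases "a = 0")
    case True
    have "\<psi> (cscale 0 0) x = hscale 0 (\<psi> 0 x)" by (rule lin'(1)[OF D'(3)])
    then have "\<psi> a x = 0" using True by simp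
    then show ?thesis using True by (simp add: hnorm_def)
  next
    case False
    define b where "b = cscale (of_real (1 / norm a)) a"
    have b: "b \<in> D" "norm b \<le> 1"
      using False a D'(1) by (auto simp: b_def D_def norm_cscale csubspace_def norm_divide)
    have "a = cscale (of_real (norm a)) b"
      using False by (simp add: b_def cscale_cscale cscale_one)
    then have "\<psi> a x = hscale (of_real (norm a)) (\<psi> b x)"
      using lin'(1)[OF b(1)] by metis
    then show ?thesis
      using unit_ball[OF b] by (simp add: hnorm_hscale mult_left_mono)
  qed
qed

section \<open>Two by two matrices\<close>

lemma sum_lessThan_double:
  "(\<Sum>l<2 * n. f l) = (\<Sum>k<n. f (2 * k)) + (\<Sum>k<n. f (2 * k + 1 :: nat) :: 'b::comm_monoid_add)"
  by (induction n) (simp_all add: ac_simps)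

text \<open>In the block ordering, even and odd summation indices run through the upper and lower
  rows of the blocks of \<open>G\<close>, which gives the two sums.\<close>

lemma pos_mat_M2_corners:
  assumes "pos_mat_M2 D n F"
  shows "\<exists>G. (\<forall>i<n. \<forall>j<n. G i j \<in> D) \<and>
    (\<forall>i<n. \<forall>j<n. \<forall>r<2. \<forall>s<2. m2_entry (F i j) r s
      = (\<Sum>k<n. cstar (m2_entry (G k i) 0 r) * m2_entry (G k j) 0 s)
      + (\<Sum>k<n. cstar (m2_entry (G k i) 1 r) * m2_entry (G k j) 1 s))"
proof -
  obtain G where G: "\<forall>i<n. \<forall>j<n. G i j \<in> D"
    and F: "\<forall>i<2 * n. \<forall>j<2 * n. flat2 F i j = mprod (2 * n) (madj (flat2 G)) (flat2 G) i j"
    using assms unfolding pos_mat_M2_def by (elim exE conjE)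
  show ?thesis
  proof (intro exI[of _ G] conjI G allI impI)
    fix i j r s :: nat
    assume h: "i < n" "j < n" "r < 2" "s < 2"
    have flat: "flat2 H (2 * k + p) (2 * l + q) = m2_entry (H k l) p q"
      if "p < 2" "q < 2" for H :: "nat \<Rightarrow> nat \<Rightarrow> 'a m2" and k l p q
      using that by (simp add: flat2_def)
    have "m2_entry (F i j) r s = flat2 F (2 * i + r) (2 * j + s)"
      using h by (simp add: flat)
    also have "\<dots> = (\<Sum>l<2 * n. cstar (flat2 G l (2 * i + r)) * flat2 G l (2 * j + s))"
      using h by (subst F[rule_format]) (auto simp: mprod_def madj_def)
    also have "\<dots> = (\<Sum>k<n. cstar (m2_entry (G k i) 0 r) * m2_entry (G k j) 0 s)
      + (\<Sum>k<n. cstar (m2_entry (G k i) 1 r) * m2_entry (G k j) 1 s)"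
      unfolding sum_lessThan_double
      using h flat[of 0 r G] flat[of 0 s G] flat[of 1 r G] flat[of 1 s G] by simp
    finally show "m2_entry (F i j) r s
      = (\<Sum>k<n. cstar (m2_entry (G k i) 0 r) * m2_entry (G k j) 0 s)
      + (\<Sum>k<n. cstar (m2_entry (G k i) 1 r) * m2_entry (G k j) 1 s)" .
  qed
qed

text \<open>A factor of \<open>F\<close> padded with zeros is a factor of the padded matrix.\<close>

lemma pos_mat_M2_upper_left:
  assumes "pos_mat_A D n F" and E: "\<And>a. a \<in> D \<Longrightarrow> (a, 0, 0, 0) \<in> E"
  shows "pos_mat_M2 E n (\<lambda>i j. (F i j, 0, 0, 0))"
proof -
  obtain G where G: "\<forall>i<n. \<forall>j<n. G i j \<in> D"
    and F: "\<forall>i<n. \<forall>j<n. F i j = (\<Sum>k<n. cstar (G k i) * G k j)"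
    using assms(1) unfolding pos_mat_A_def mprod_def madj_def by (elim exE conjE)
  have "flat2 (\<lambda>i j. (F i j, 0, 0, 0)) i j
      = mprod (2 * n) (madj (flat2 (\<lambda>i j. (G i j, 0, 0, 0)))) (flat2 (\<lambda>i j. (G i j, 0, 0, 0))) i j"
    if "i < 2 * n" "j < 2 * n" for i j
  proof -
    have "i div 2 < n" "j div 2 < n" using that by auto
    then show ?thesis
      unfolding mprod_def madj_def sum_lessThan_double
      by (auto simp: flat2_def m2_entry_def F)
  qed
  then show ?thesis
    unfolding pos_mat_M2_def using G E
    by (intro exI[of _ "\<lambda>i j. (G i j, 0, 0, 0)"]) auto
qed

theorem theorem2p7:
  fixes X J :: "'a::cstar_alg set"
    and PI :: "'a m2 \<Rightarrow> 'h::chilbert \<Rightarrow> 'h"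
    and \<pi> :: "'a \<Rightarrow> 'h \<Rightarrow> 'h"
  assumes "closed_ideal J"
    and "operator_system X"
    and "star_rep_M2 (BXJ X J) PI"
    and "PI m2_one = id"
    and "\<forall>m\<in>M2 J. PI m = (\<lambda>_. 0)"
    and "star_rep_A (setsum (cstar_gen X) J) \<pi>"
    and "adapted X J PI \<pi>"
  shows "UEP X J PI \<longleftrightarrow>
    (ccp_A (setsum (cstar_gen X) J) \<pi> \<and>
     (\<forall>\<psi>. ccp_A (setsum (cstar_gen X) J) \<psi> \<and> (\<forall>x\<in>X. \<psi> x = \<pi> x)
        \<longrightarrow> (\<forall>a\<in>setsum (cstar_gen X) J. \<psi> a = \<pi> a)))"
proof -

  \<comment> \<open>The algebras of the two diagonal corners\<close>
  define C where "C = cstar_gen X"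
  define D where "D = setsum C J"
  define B where "B = BXJ X J"
  define U where "U = unitize J"
  note J = assms(1)
  have J': "csubspace J" "0 \<in> J" using J by (auto simp: closed_ideal_def csubspace_def)
  have X: "0 \<in> X" "1 \<in> X" "X \<subseteq> C"
    using assms(2) subset_cstar_gen by (auto simp: C_def operator_system_def csubspace_def)
  have C: "cstar_subalgebra C" "1 \<in> C"
    using cstar_subalgebra_cstar_gen X by (auto simp: C_def)
  have usC: "unital_star_subalgebra C"
    using C by (simp add: unital_star_subalgebra_def cstar_subalgebra_def)
  have usD: "unital_star_subalgebra D"
    unfolding D_def by (rule unital_star_subalgebra_setsum[OF usC J])
  have usU: "unital_star_subalgebra U"
    unfolding U_def unitize_eq_setsum
    by (rule unital_star_subalgebra_setsum[OF unital_star_subalgebra_scalars J])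
  have D': "csubspace D" "0 \<in> D" "1 \<in> D" "\<And>x y. x \<in> D \<Longrightarrow> y \<in> D \<Longrightarrow> x + y \<in> D"
      "\<And>c x. x \<in> D \<Longrightarrow> cscale c x \<in> D"
    and U': "csubspace U" "0 \<in> U" "1 \<in> U" "\<And>x y. x \<in> U \<Longrightarrow> y \<in> U \<Longrightarrow> x + y \<in> U"
      "\<And>c x. x \<in> U \<Longrightarrow> cscale c x \<in> U"
    using usD usU by (auto simp: unital_star_subalgebra_def csubspace_def)
  have XD: "X \<subseteq> D" and JD: "J \<subseteq> D" and JU: "J \<subseteq> U"
  proof -
    show "X \<subseteq> D" unfolding D_def subset_iff setsum_iff using X J' by (metis add.right_neutral subsetD)
    show "J \<subseteq> D" unfolding D_def subset_iff setsum_iff using usC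
      by (metis add.left_neutral subspace_0 unital_star_subalgebra_subspace)
    show "J \<subseteq> U"
    proof
      fix j assume "j \<in> J"
      then show "j \<in> U"
        unfolding U_def unitize_def by (intro CollectI exI[of _ j] exI[of _ 0]) simp
    qed
  qed
  have B: "(a, b, c, d) \<in> B \<longleftrightarrow> a \<in> D \<and> b \<in> J \<and> c \<in> J \<and> d \<in> U" for a b c d
    by (auto simp: B_def BXJ_def D_def C_def U_def)
  have S: "(a, b, c, d) \<in> SXJ X J \<longleftrightarrow> a \<in> X \<and> b \<in> J \<and> c \<in> J \<and> d \<in> U" for a b c d
    by (auto simp: SXJ_def U_def)

  \<comment> \<open>The representations that \<open>PI\<close> induces on the corners\<close>
  have PI: "star_rep_M2 B PI" using assms(3) by (simp add: B_def)
  then have lin_PI: "lin_map_on m2_add m2_scale B PI" by (simp add: star_rep_def)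
  have \<pi>: "star_rep_A D \<pi>" using assms(6) by (simp add: D_def C_def)
  then have lin_\<pi>: "lin_map_on (+) cscale D \<pi>" by (simp add: star_rep_def)
  have add_B: "\<phi> (a + a', b + b', c + c', d + d') x = \<phi> (a, b, c, d) x + \<phi> (a', b', c', d') x"
    if "lin_map_on m2_add m2_scale B \<phi>" "(a, b, c, d) \<in> B" "(a', b', c', d') \<in> B"
    for \<phi> :: "'a m2 \<Rightarrow> 'h \<Rightarrow> 'h" and a b c d a' b' c' d' x
  proof -
    have "\<phi> (m2_add (a, b, c, d) (a', b', c', d')) = (\<lambda>x. \<phi> (a, b, c, d) x + \<phi> (a', b', c', d') x)"
      using that unfolding lin_map_on_def by blast
    then show ?thesis by (simp add: m2_add_def)
  qed
  \<comment> \<open>If \<open>1 \<in> J\<close>, then \<open>chi J\<close> is not determined by its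
    description, but \<open>PI\<close> annihilates the unit and the Hilbert space is zero. Otherwise
    \<open>chi J 0 = 0\<close>, and adaptedness reduces to the claim.\<close>
  have PI_\<pi>: "PI (a, 0, 0, 0) = \<pi> a" if a: "a \<in> D" for a
  proof (cases "1 \<in> J")
    case True
    then have "m2_one \<in> M2 J" using J' by (auto simp: M2_def m2_one_def)
    then have "id = (\<lambda>_::'h. 0::'h)" using assms(4,5) by metis
    then have "x = 0" for x :: 'h by (metis id_apply)
    then show ?thesis by (metis ext)
  next
    case False
    have "l = 0" if "cscale l 1 \<in> J" for l
    proof (rule ccontr)
      assume "l \<noteq> 0"
      then have "1 = cscale (1 / l) (cscale l (1::'a))" by (simp add: cscale_cscale cscale_one)
      with that J'(1) False show False by (metis csubspace_def)
    qed
    moreover have "0 - cscale l 1 \<in> J \<longleftrightarrow> cscale l 1 \<in> J" for l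
      using subspace_neg[OF closed_ideal_subspace[OF J]]
      by (metis diff_0 minus_minus)
    ultimately have "chi J 0 = 0"
      unfolding chi_def by (intro the_equality) (auto simp: J')
    then show ?thesis
      using assms(7) a B[of a 0 0 0] J' U' unfolding adapted_def B_def
      by (fastforce simp: fun_eq_iff)
  qed
  define \<theta> where "\<theta> d = PI (0, 0, 0, d)" for d
  have \<theta>B: "(0, 0, 0, d) \<in> B" if "d \<in> U" for d using that by (simp add: B D' J')
  have \<theta>: "star_rep_A U \<theta>"
    unfolding star_rep_def
  proof (intro conjI ballI allI)
    show "lin_map_on (+) cscale U \<theta>"
      unfolding lin_map_on_def
    proof (intro conjI ballI allI)
      fix a b c assume a: "a \<in> U"
      show "bop (\<theta> a)" using lin_PI \<theta>B[OF a] by (simp add: lin_map_on_def \<theta>_def)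
      have "PI (m2_scale c (0, 0, 0, a)) = (\<lambda>x. hscale c (PI (0, 0, 0, a) x))"
        using lin_PI \<theta>B[OF a] unfolding lin_map_on_def by blast
      then show "\<theta> (cscale c a) = (\<lambda>x. hscale c (\<theta> a x))"
        by (simp add: \<theta>_def m2_scale_def)
      assume b: "b \<in> U"
      show "\<theta> (a + b) = (\<lambda>x. \<theta> a x + \<theta> b x)"
        using add_B[OF lin_PI \<theta>B[OF a] \<theta>B[OF b]] by (simp add: \<theta>_def fun_eq_iff)
    qed
  next
    fix a b assume "a \<in> U" "b \<in> U"
    then have "PI (m2_mult (0, 0, 0, a) (0, 0, 0, b)) = PI (0, 0, 0, a) \<circ> PI (0, 0, 0, b)"
      using PI \<theta>B unfolding star_rep_def by blast
    then show "\<theta> (a * b) = \<theta> a \<circ> \<theta> b" by (simp add: m2_mult_def \<theta>_def)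
  next
    fix a x y assume "a \<in> U"
    then have "cinner (PI (m2_star (0, 0, 0, a)) x) y = cinner x (PI (0, 0, 0, a) y)"
      using PI \<theta>B unfolding star_rep_def by blast
    then show "cinner (\<theta> (cstar a) x) y = cinner x (\<theta> a y)" by (simp add: m2_star_def \<theta>_def)
  qed
  then have lin_\<theta>: "lin_map_on (+) cscale U \<theta>" by (simp add: star_rep_def)
  \<comment> \<open>\<open>\<pi> 1\<close> is a self-adjoint idempotent; expand the squared norm of
    \<open>x - \<pi> 1 x\<close>.\<close>
  have one_le: "Re (cinner (\<pi> 1 x) x) \<le> Re (cinner x x)" for x
  proof -
    have "\<pi> (1 * 1) = \<pi> 1 \<circ> \<pi> 1" "\<And>x y. cinner (\<pi> (cstar 1) x) y = cinner x (\<pi> 1 y)"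
      using \<pi> D'(3) unfolding star_rep_def by blast+
    then have p: "\<pi> 1 (\<pi> 1 x) = \<pi> 1 x" "\<And>x y. cinner (\<pi> 1 x) y = cinner x (\<pi> 1 y)"
      by (simp_all add: fun_eq_iff)
    have "0 \<le> Re (cinner (x + hscale (- 1) (\<pi> 1 x)) (x + hscale (- 1) (\<pi> 1 x)))"
      by (rule Re_cinner_self_nonneg)
    also have "\<dots> = Re (cinner x x) - Re (cinner (\<pi> 1 x) x)"
      using p(2)[of x x] p(2)[of x "\<pi> 1 x"]
      by (simp add: cinner_add_left cinner_add_right cinner_hscale_left cinner_hscale_right p(1))
    finally show ?thesis by simp
  qed
  have ccpI: "ccp_A D \<psi>"
    if "lin_map_on (+) cscale D \<psi>" "comp_pos (pos_mat_A D) D \<psi>" "\<psi> 1 = \<pi> 1" for \<psi> :: "'a \<Rightarrow> 'h \<Rightarrow> 'h"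
    using that comp_pos_contractive[OF C J, of \<psi>] one_le unfolding ccp_A_def D_def by auto

  \<comment> \<open>From the unique extension property to uniqueness of \<open>\<pi>\<close>\<close>
  have "ccp_A D \<pi>"
    by (rule ccpI[OF lin_\<pi> star_rep_comp_pos[OF usD \<pi>] refl])
  moreover have "\<psi> a = \<pi> a"
    if uep: "UEP X J PI" and \<psi>: "ccp_A D \<psi>" and eq: "\<And>x. x \<in> X \<Longrightarrow> \<psi> x = \<pi> x" and a: "a \<in> D"
    for \<psi> :: "'a \<Rightarrow> 'h \<Rightarrow> 'h" and a
  proof -
    \<comment> \<open>The off-diagonal entries are dropped, in accordance with \<open>PI\<close>
      annihilating them on \<open>SXJ X J\<close>.\<close>
    define \<phi> where "\<phi> m = (\<lambda>x. \<psi> (m2_entry m 0 0) x + \<theta> (m2_entry m 1 1) x)" for m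
    have \<phi>: "\<phi> (a, b, c, d) x = \<psi> a x + \<theta> d x" for a b c d x
      by (simp add: \<phi>_def m2_entry_def)
    have lin_\<psi>: "lin_map_on (+) cscale D \<psi>" and cp_\<psi>: "comp_pos (pos_mat_A D) D \<psi>"
      using \<psi> by (auto simp: ccp_A_def)
    have lin_\<phi>: "lin_map_on m2_add m2_scale B \<phi>"
      unfolding lin_map_on_def
    proof (intro conjI ballI allI)
      fix m n l assume "m \<in> B"
      then obtain a b c d where m: "m = (a, b, c, d)" "a \<in> D" "d \<in> U"
        using B by (metis prod_cases4)
      have "bop (\<psi> a)" "bop (\<theta> d)"
        using lin_\<psi> lin_\<theta> m by (auto simp: lin_map_on_def)
      then show "bop (\<phi> m)" by (simp add: m \<phi>_def m2_entry_def bop_add)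
      show "\<phi> (m2_scale l m) = (\<lambda>x. hscale l (\<phi> m x))"
        using lin_\<psi> lin_\<theta> m by (simp add: fun_eq_iff m2_scale_def \<phi> lin_map_on_def hscale_add_right)
      assume "n \<in> B"
      then obtain a' b' c' d' where n: "n = (a', b', c', d')" "a' \<in> D" "d' \<in> U"
        using B by (metis prod_cases4)
      show "\<phi> (m2_add m n) = (\<lambda>x. \<phi> m x + \<phi> n x)"
        using lin_\<psi> lin_\<theta> m n by (simp add: fun_eq_iff m2_add_def \<phi> lin_map_on_def add_ac)
    qed
    have agree: "\<phi> s = PI s" if s: "s \<in> SXJ X J" for s
    proof -
      obtain x j k b where s: "s = (x, j, k, b)" "x \<in> X" "j \<in> J" "k \<in> J" "b \<in> U"
        using s S by (metis prod_cases4)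
      have "PI (0, j, k, 0) = (\<lambda>_. 0)"
        using s J' assms(5) by (auto simp: M2_def)
      moreover have "PI (x + 0, 0 + j, 0 + k, 0 + 0) y = PI (x, 0, 0, 0) y + PI (0, j, k, 0) y"
        and "PI (x + 0, j + 0, k + 0, 0 + b) y = PI (x, j, k, 0) y + PI (0, 0, 0, b) y" for y
        by (rule add_B[OF lin_PI]; use s XD J' D' U' in \<open>auto simp: B\<close>)+
      ultimately show ?thesis
        using s XD by (auto simp: fun_eq_iff \<phi> eq PI_\<pi> \<theta>_def)
    qed
    have "m2_one \<in> SXJ X J"
      by (simp add: m2_one_def S X J' U')
    then have one: "\<phi> m2_one = id" using agree assms(4) by simp
    have "comp_pos (pos_mat_M2 B) B \<phi>"
      unfolding comp_pos_def
    proof (intro allI impI, elim conjE)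
      fix n F assume "pos_mat_M2 B n F"
      then obtain G where G: "\<And>i j. i < n \<Longrightarrow> j < n \<Longrightarrow> G i j \<in> B"
        and F: "\<forall>i<n. \<forall>j<n. \<forall>r<2. \<forall>s<2. m2_entry (F i j) r s
          = (\<Sum>k<n. cstar (m2_entry (G k i) 0 r) * m2_entry (G k j) 0 s)
          + (\<Sum>k<n. cstar (m2_entry (G k i) 1 r) * m2_entry (G k j) 1 s)"
        using pos_mat_M2_corners by blast
      \<comment> \<open>Off-diagonal entries lie in \<open>J\<close>, hence in both corner algebras.
        So the first columns of the blocks lie in \<open>D\<close> and the second columns in
        \<open>U\<close>, as the two Gram sums require.\<close>
      have entries: "m2_entry (G i j) 0 0 \<in> D" "m2_entry (G i j) 0 1 \<in> U"
        "m2_entry (G i j) 1 0 \<in> D" "m2_entry (G i j) 1 1 \<in> U" if "i < n" "j < n" for i j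
      proof -
        obtain a b c d where "G i j = (a, b, c, d)" by (metis prod_cases4)
        with G[OF that] JD JU show "m2_entry (G i j) 0 0 \<in> D" "m2_entry (G i j) 0 1 \<in> U"
          "m2_entry (G i j) 1 0 \<in> D" "m2_entry (G i j) 1 1 \<in> U"
          by (auto simp: B m2_entry_def)
      qed
      have "pos_opmat n (\<lambda>i j. \<psi> (m2_entry (F i j) 0 0))"
        by (rule comp_pos_two_squares[OF usD lin_\<psi> cp_\<psi>]) (use entries F in auto)
      moreover have "pos_opmat n (\<lambda>i j. \<theta> (m2_entry (F i j) 1 1))"
        by (rule comp_pos_two_squares[OF usU lin_\<theta> star_rep_comp_pos[OF usU \<theta>]]) (use entries F in auto)
      ultimately show "pos_opmat n (\<lambda>i j. \<phi> (F i j))"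
        by (rule pos_opmat_add) (simp add: \<phi>_def)
    qed
    then have "ucp_M2 B \<phi>" using lin_\<phi> one by (simp add: ucp_M2_def)
    moreover have aB: "(a, 0, 0, 0) \<in> B" using a J' U' by (simp add: B)
    ultimately have "\<phi> (a, 0, 0, 0) = PI (a, 0, 0, 0)"
      using uep agree unfolding UEP_def B_def by blast
    moreover have "\<theta> 0 = (\<lambda>_. 0)"
      using assms(5) J' by (auto simp: \<theta>_def M2_def)
    ultimately show ?thesis
      by (simp add: PI_\<pi> a \<phi> fun_eq_iff)
  qed

  \<comment> \<open>From uniqueness of \<open>\<pi>\<close> to the unique extension property\<close>
  moreover have "UEP X J PI"
    if uniq: "\<And>\<psi> a. ccp_A D \<psi> \<Longrightarrow> (\<And>x. x \<in> X \<Longrightarrow> \<psi> x = \<pi> x) \<Longrightarrow> a \<in> D \<Longrightarrow> \<psi> a = \<pi> a"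
    unfolding UEP_def
  proof (intro allI impI ballI, elim conjE)
    fix \<phi> m
    assume "ucp_M2 (BXJ X J) \<phi>" and agree: "\<forall>s\<in>SXJ X J. \<phi> s = PI s" and m: "m \<in> BXJ X J"
    then have lin_\<phi>: "lin_map_on m2_add m2_scale B \<phi>" and cp_\<phi>: "comp_pos (pos_mat_M2 B) B \<phi>"
      by (auto simp: ucp_M2_def B_def)
    define \<psi> where "\<psi> a = \<phi> (a, 0, 0, 0)" for a
    have \<psi>B: "(a, 0, 0, 0) \<in> B" if "a \<in> D" for a using that J' U' by (simp add: B)
    have eq: "\<psi> x = \<pi> x" if "x \<in> X" for x
      using that agree XD J' U' by (auto simp: \<psi>_def S PI_\<pi>)
    have lin_\<psi>: "lin_map_on (+) cscale D \<psi>"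
      unfolding lin_map_on_def
    proof (intro conjI ballI allI)
      fix a b c assume a: "a \<in> D"
      show "bop (\<psi> a)" using lin_\<phi> \<psi>B[OF a] by (simp add: lin_map_on_def \<psi>_def)
      have "\<phi> (m2_scale c (a, 0, 0, 0)) = (\<lambda>x. hscale c (\<phi> (a, 0, 0, 0) x))"
        using lin_\<phi> \<psi>B[OF a] unfolding lin_map_on_def by blast
      then show "\<psi> (cscale c a) = (\<lambda>x. hscale c (\<psi> a x))"
        by (simp add: \<psi>_def m2_scale_def)
      assume b: "b \<in> D"
      show "\<psi> (a + b) = (\<lambda>x. \<psi> a x + \<psi> b x)"
        using add_B[OF lin_\<phi> \<psi>B[OF a] \<psi>B[OF b]] by (simp add: \<psi>_def fun_eq_iff)
    qed
    have "comp_pos (pos_mat_A D) D \<psi>"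
      unfolding comp_pos_def
    proof (intro allI impI, elim conjE)
      fix n F
      assume F: "\<forall>i<n. \<forall>j<n. F i j \<in> D" "pos_mat_A D n F"
      have "pos_mat_M2 B n (\<lambda>i j. (F i j, 0, 0, 0))"
        by (rule pos_mat_M2_upper_left[OF F(2) \<psi>B])
      then show "pos_opmat n (\<lambda>i j. \<psi> (F i j))"
        using cp_\<phi>[unfolded comp_pos_def, rule_format, of n "\<lambda>i j. (F i j, 0, 0, 0)"] F(1) \<psi>B
        by (simp add: \<psi>_def)
    qed
    \<comment> \<open>Contractivity is obtained from \<open>\<psi> 1 = \<pi> 1\<close>, which holds
      because \<open>1 \<in> X\<close>.\<close>
    then have "ccp_A D \<psi>" by (rule ccpI[OF lin_\<psi>]) (simp add: eq X)
    then have \<psi>_\<pi>: "\<psi> a = \<pi> a" if "a \<in> D" for a using uniq eq that by blast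
    obtain a b c d where abcd: "m = (a, b, c, d)" "a \<in> D" "b \<in> J" "c \<in> J" "d \<in> U"
      using m B by (metis B_def prod_cases4)
    \<comment> \<open>The remainder \<open>(0, b, c, d)\<close> already lies in
      \<open>SXJ X J\<close>, as \<open>0 \<in> X\<close>; only the upper left corner has to be
      compared.\<close>
    have split: "\<eta> (a + 0, 0 + b, 0 + c, 0 + d) x = \<eta> (a, 0, 0, 0) x + \<eta> (0, b, c, d) x"
      if "lin_map_on m2_add m2_scale B \<eta>" for \<eta> :: "'a m2 \<Rightarrow> 'h \<Rightarrow> 'h" and x
      using abcd J' U' D' by (intro add_B[OF that]) (simp_all add: B)
    have "\<phi> (0, b, c, d) = PI (0, b, c, d)"
      using agree abcd X by (simp add: S)
    then show "\<phi> m = PI m"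
      using split[OF lin_\<phi>] split[OF lin_PI] \<psi>_\<pi>[OF abcd(2)] PI_\<pi>[OF abcd(2)]
      by (simp add: abcd fun_eq_iff \<psi>_def)
  qed
  ultimately show ?thesis
    unfolding D_def C_def by blast
qed

end
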